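(* Let $A_1,A_2$ be two $\mathcal P$-free sub-algebras of a $\mathcal P$-tracial algebra $(A,(m_p)_{p\in\mathcal P})$. Let $k\ge0$, $(a_1,\dots,a_k)\in A_1^k$, $(b_1,\dots,b_k)\in A_2^k$ and $p\in\mathcal P_k$. Then $$\kappa_p(a_1+b_1,\dots,a_k+b_k)=\sum_{(p_1,p_2,I)\in\mathfrak F_2(p)}\kappa_{p_1}\big((a_i)_{i\in I}\big)\,\kappa_{p_2}\big((b_i)_{i\in\{1,\dots,k\}\setminus I}\big),$$ $$\kappa_p(a_1b_1,\dots,a_kb_k)=\sum_{p_1\prec p,\ p_2\in K_p(p_1)}\kappa_{p_1}(a_1,\dots,a_k)\,\kappa_{p_2}(b_1,\dots,b_k),$$ $$m_p(a_1b_1,\dots,a_kb_k)=\sum_{p_1\in\mathcal P_k,\ p_1\le p}\kappa_{p_1}(a_1,\dots,a_k)\,m_{{}^tp_1\circ p}(b_1,\dots,b_k).$$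
   Context: Partitions. For $k\ge 0$, $\mathcal P_k$ is the set of partitions of $\{1,\dots,k,1',\dots,k'\}$ ($\mathcal P_0=\{\emptyset\}$) and $\mathcal P=\bigcup_k\mathcal P_k$. A partition is drawn as a diagram with a top row $1,\dots,k$ and a bottom row $1',\dots,k'$. $\mathrm{nc}(p)$ is the number of blocks of $p$; $p\vee p'$ is the finest partition coarser than both; $\mathrm{id}_k=\{\{i,i'\}:1\le i\le k\}$. The cycles of $p$ are the blocks of $p\vee\mathrm{id}_k$. A permutation $\sigma$ is identified with $\{\{i,\sigma(i)'\}\}$. ${}^tp$ is obtained by exchanging $i$ and $i'$ for every $i$. $p\circ p'$ is obtained by putting $p'$ above $p$, identifying the bottom row of $p'$ with the top row of $p$, then erasing the middle row and keeping connections. $p\otimes p'$ is obtained by putting $p'$ to the right of $p$. Set $d(p,p')=\frac{\mathrm{nc}(p)+\mathrm{nc}(p')}{2}-\mathrm{nc}(p\vee p')$ and $p\le p'$ if $d(\mathrm{id}_k,p)+d(p,p')=d(\mathrm{id}_k,p')$ (a partial order). Factorizations: for $I\subset\{1,\dots,k\}$, the extraction $p_I$ is the partition formed by the non-empty intersections of blocks of $p$ with $I\cup I'$, relabelled increasingly. $\mathfrak F_2(p)$ is the set of triples $(p_1,p_2,I)$ with $I\subset\{1,\dots,k\}$, $p_1=p_I$, $p_2=p_{\{1,\dots,k\}\setminus I}$ and $\mathrm{nc}(p_1)+\mathrm{nc}(p_2)=\mathrm{nc}(p)$. Kreweras complement: for $p,p_1\in\mathcal P_k$, $K_p(p_1)$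 is the set of $p_2\in\mathcal P_k$ such that $p_1\circ p_2=p$ and $p_1\otimes p_2\le (p\otimes\mathrm{id}_k)\circ\tau$ in $\mathcal P_{2k}$, where $\tau=(1,k+1)(2,k+2)\cdots(k,2k)$; $p_1\prec p$ means $K_p(p_1)\neq\emptyset$. $\mathcal P$-tracial algebra. For $p\in\mathcal P_k$, $l\ge k$ and $1\le i_1<\dots<i_k\le l$, the insertion $\mathrm{Ins}^l_{(i_1,\dots,i_k)}(p)\in\mathcal P_l$ is obtained by relabelling $j\mapsto i_j$, $j'\mapsto i_j'$ in $p$ and adding the blocks $\{i,i'\}$ for $i\notin\{i_1,\dots,i_k\}$. A $\mathcal P$-tracial algebra $(A,(m_p)_{p\in\mathcal P})$ is a (complex) algebra $A$ with $k$-linear forms $m_p:A^k\to\mathbb C$ for $p\in\mathcal P_k$ ($m_\emptyset=1$) such that (1) $m_p(a_1,\dots,a_k)=m_{\sigma\circ p\circ\sigma^{-1}}(a_{\sigma^{-1}(1)},\dots,a_{\sigma^{-1}(k)})$ for all $\sigma\in\mathfrak S_k$; (2) $m_p\big(\prod_{i=1}^{n_1}a^{(1)}_i,\dots,\prod_{i=1}^{n_k}a_i^{(k)}\big)=m_{\mathrm{Ins}^{n}_{\mathbf i}(p)\circ\sigma}(a^{(1)}_1,\dots,a^{(1)}_{n_1},\dots,a^{(k)}_1,\dots,a^{(k)}_{n_k})$, with $n=\sum_j n_j$, $\mathbf i=(1,1+n_1,\dots,1+n_1+\dots+n_{k-1})$ and $\sigma=(1,\dots,n_1)(n_1+1,\dots,n_1+n_2)\cdots(n_1+\dots+n_{k-1}+1,\dots,n)$.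 The $\mathcal P$-cumulants $(\kappa_p)$ are the unique multilinear forms with $m_p=\sum_{p'\in\mathcal P_k,\,p'\le p}\kappa_{p'}$ for all $k$ and $p\in\mathcal P_k$ ($\kappa_\emptyset=1$). $\mathcal P$-freeness. Sub-algebras $A_1,A_2$ are $\mathcal P$-free if: (i) for all $k$, $p\in\mathcal P_k$, and $(a_1,\dots,a_k)$ with $a_i\in A_{\epsilon(i)}$, $\epsilon(i)\in\{1,2\}$, if some cycle of $p$ contains $i$ and $j$ with $\epsilon(i)\ne\epsilon(j)$ then $\kappa_p(a_1,\dots,a_k)=0$; (ii) for $p_1\in\mathcal P_{k_1},p_2\in\mathcal P_{k_2}$, $(a_1,\dots,a_{k_1})\in A_1^{k_1}$, $(a_{k_1+1},\dots,a_{k_1+k_2})\in A_2^{k_2}$: $\kappa_{p_1\otimes p_2}(a_1,\dots,a_{k_1+k_2})=\kappa_{p_1}(a_1,\dots,a_{k_1})\kappa_{p_2}(a_{k_1+1},\dots,a_{k_1+k_2})$. *)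

theory Defs
  imports
    Complex_Main
    "HOL-Library.Disjoint_Sets"
    "HOL-Combinatorics.Permutations"
    "HOL-Combinatorics.Cycles"
begin

text \<open>
  Positions are counted from 0, as in lists: the column \<open>i\<close> of the mathematical text is the
  column \<open>i - 1\<close> here.  The vertex \<open>i\<close> is \<open>(Top, i)\<close>, the vertex \<open>i'\<close> is \<open>(Bottom, i)\<close>; the row
  \<open>Middle\<close> only occurs as the erased row of a composition.
\<close>

datatype row = Top | Middle | Bottom

type_synonym vertex = "row \<times> nat"
type_synonym diagram = "vertex set set"

definition Part :: "nat \<Rightarrow> diagram set" where
  "Part k = {p. partition_on ({Top, Bottom} \<times> {..<k}) p}"

definition nc :: "diagram \<Rightarrow> nat" where
  "nc p = card p"

definition relabel :: "(vertex \<Rightarrow> vertex) \<Rightarrow> diagram \<Rightarrow> diagram" where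
  "relabel f p = (\<lambda>B. f ` B) ` p"

definition restrict_diagram :: "vertex set \<Rightarrow> diagram \<Rightarrow> diagram" where
  "restrict_diagram V p = (\<lambda>B. B \<inter> V) ` p - {{}}"

text \<open>
  The connected components of a family of sets: two points are connected if they are joined by a
  chain of members of the family, consecutive members of which overlap.
\<close>

definition components :: "'v set set \<Rightarrow> 'v set set" where
  "components F = \<Union>F // (\<Union>B\<in>F. B \<times> B)\<^sup>+"

definition pjoin :: "diagram \<Rightarrow> diagram \<Rightarrow> diagram" (infixl "\<squnion>\<^sub>P" 65) where
  "p \<squnion>\<^sub>P q = components (p \<union> q)"

lemma equiv_components: "equiv (\<Union>F) ((\<Union>B\<in>F. B \<times> B)\<^sup>+)"
proof (rule equivI)
  let ?r = "\<Union>B\<in>F. B \<times> B"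
  show "?r\<^sup>+ \<subseteq> \<Union>F \<times> \<Union>F"
    by (rule trancl_subset_Sigma) auto
  show "refl_on (\<Union>F) (?r\<^sup>+)"
    by (rule refl_onI) (auto intro: r_into_trancl)
  show "sym (?r\<^sup>+)"
    by (rule sym_trancl) (auto simp: sym_def)
  show "trans (?r\<^sup>+)"
    by (rule trans_trancl)
qed

lemma partition_on_components: "partition_on (\<Union>F) (components F)"
  unfolding components_def by (rule partition_on_quotient[OF equiv_components])

lemma components_coarser:
  assumes "B \<in> F" "B \<noteq> {}"
  shows "\<exists>C\<in>components F. B \<subseteq> C"
proof -
  from assms obtain x where x: "x \<in> B" by auto
  let ?C = "(\<Union>B\<in>F. B \<times> B)\<^sup>+ `` {x}"
  have "?C \<in> components F"
    unfolding components_def using x assms by (auto intro: quotientI)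
  moreover have "B \<subseteq> ?C"
    using x assms by (auto intro!: r_into_trancl)
  ultimately show ?thesis by blast
qed

lemma components_finest:
  assumes part: "partition_on (\<Union>F) R"
    and coarser: "\<And>B. B \<in> F \<Longrightarrow> \<exists>D\<in>R. B \<subseteq> D"
    and C: "C \<in> components F"
  shows "\<exists>D\<in>R. C \<subseteq> D"
proof -
  let ?r = "\<Union>B\<in>F. B \<times> B"
  from C obtain x where x: "x \<in> \<Union>F" and Ceq: "C = ?r\<^sup>+ `` {x}"
    unfolding components_def by (elim quotientE)
  from x part obtain D where D: "D \<in> R" "x \<in> D"
    by (auto simp: partition_on_def)
  have step: "z \<in> D" if yz: "(y, z) \<in> ?r" and y: "y \<in> D" for y z
  proof -
    from yz obtain B where B: "B \<in> F" "y \<in> B" "z \<in> B" by auto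
    from coarser[OF B(1)] obtain D' where D': "D' \<in> R" "B \<subseteq> D'" by auto
    have "D' = D"
      using disjointD[OF partition_onD2[OF part] D'(1) D(1)] D'(2) y B(2) by blast
    then show ?thesis using D' B by auto
  qed
  have "z \<in> D" if "(x, z) \<in> ?r\<^sup>+" for z
    using that by (induction rule: trancl_induct) (use D step in auto)
  then show ?thesis using D(1) unfolding Ceq by auto
qed

lemma pjoin_finest_common_coarsening:
  assumes p: "partition_on V p" and q: "partition_on V q"
  shows "partition_on V (p \<squnion>\<^sub>P q)"
    and "\<forall>B\<in>p \<union> q. \<exists>C\<in>p \<squnion>\<^sub>P q. B \<subseteq> C"
    and "partition_on V r \<Longrightarrow> \<forall>B\<in>p \<union> q. \<exists>D\<in>r. B \<subseteq> D \<Longrightarrow> \<forall>C\<in>p \<squnion>\<^sub>P q. \<exists>D\<in>r. C \<subseteq> D"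
proof -
  have V: "\<Union>(p \<union> q) = V"
    using partition_onD1[OF p] partition_onD1[OF q] by auto
  show "partition_on V (p \<squnion>\<^sub>P q)"
    unfolding pjoin_def using partition_on_components[of "p \<union> q"] V by simp
  show "\<forall>B\<in>p \<union> q. \<exists>C\<in>p \<squnion>\<^sub>P q. B \<subseteq> C"
    unfolding pjoin_def using components_coarser[of _ "p \<union> q"] partition_onD3[OF p] partition_onD3[OF q]
    by (metis Un_iff)
  show "\<forall>C\<in>p \<squnion>\<^sub>P q. \<exists>D\<in>r. C \<subseteq> D"
    if "partition_on V r" "\<forall>B\<in>p \<union> q. \<exists>D\<in>r. B \<subseteq> D"
  proof
    fix C assume "C \<in> p \<squnion>\<^sub>P q"
    then show "\<exists>D\<in>r. C \<subseteq> D"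
      unfolding pjoin_def using components_finest[of "p \<union> q" r C] that V by simp
  qed
qed

definition perm_diagram :: "nat \<Rightarrow> (nat \<Rightarrow> nat) \<Rightarrow> diagram" where
  "perm_diagram k \<sigma> = {{(Top, i), (Bottom, \<sigma> i)} | i. i < k}"

definition id_diagram :: "nat \<Rightarrow> diagram" where
  "id_diagram k = {{(Top, i), (Bottom, i)} | i. i < k}"

definition cycles :: "nat \<Rightarrow> diagram \<Rightarrow> diagram" where
  "cycles k p = p \<squnion>\<^sub>P id_diagram k"

fun flip_vertex :: "vertex \<Rightarrow> vertex" where
  "flip_vertex (Top, i) = (Bottom, i)"
| "flip_vertex (Bottom, i) = (Top, i)"
| "flip_vertex (Middle, i) = (Middle, i)"

definition flip :: "diagram \<Rightarrow> diagram" where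
  "flip p = relabel flip_vertex p"

text \<open>In \<open>p \<circ>\<^sub>P q\<close> the diagram \<open>q\<close> is placed above \<open>p\<close>.\<close>

definition pcomp :: "diagram \<Rightarrow> diagram \<Rightarrow> diagram" (infixl "\<circ>\<^sub>P" 70) where
  "p \<circ>\<^sub>P q =
     restrict_diagram ({Top, Bottom} \<times> UNIV)
       (components
         (relabel (\<lambda>(r, i). (if r = Bottom then Middle else r, i)) q \<union>
          relabel (\<lambda>(r, i). (if r = Top then Middle else r, i)) p))"

text \<open>The number \<open>k\<close> is the number of columns of the left factor \<open>p\<close>.\<close>

definition ptensor :: "nat \<Rightarrow> diagram \<Rightarrow> diagram \<Rightarrow> diagram" where
  "ptensor k p q = p \<union> relabel (\<lambda>(r, i). (r, k + i)) q"

definition pdist :: "diagram \<Rightarrow> diagram \<Rightarrow> real" where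
  "pdist p q = (real (nc p) + real (nc q)) / 2 - real (nc (p \<squnion>\<^sub>P q))"

definition pleq :: "nat \<Rightarrow> diagram \<Rightarrow> diagram \<Rightarrow> bool" where
  "pleq k p q \<longleftrightarrow> pdist (id_diagram k) p + pdist p q = pdist (id_diagram k) q"

definition extraction :: "nat set \<Rightarrow> diagram \<Rightarrow> diagram" where
  "extraction I p =
     relabel (\<lambda>(r, i). (r, card {j \<in> I. j < i})) (restrict_diagram ({Top, Bottom} \<times> I) p)"

definition factorizations2 :: "nat \<Rightarrow> diagram \<Rightarrow> (diagram \<times> diagram \<times> nat set) set" where
  "factorizations2 k p =
     {(p1, p2, I). I \<subseteq> {..<k} \<and> p1 = extraction I p \<and> p2 = extraction ({..<k} - I) p \<and>
                   nc p1 + nc p2 = nc p}"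

definition swap_halves :: "nat \<Rightarrow> nat \<Rightarrow> nat" where
  "swap_halves k i = (if i < k then k + i else if i < 2 * k then i - k else i)"

definition kreweras :: "nat \<Rightarrow> diagram \<Rightarrow> diagram \<Rightarrow> diagram set" where
  "kreweras k p p1 =
     {p2 \<in> Part k. p1 \<circ>\<^sub>P p2 = p \<and>
        pleq (2 * k) (ptensor k p1 p2)
          (ptensor k p (id_diagram k) \<circ>\<^sub>P perm_diagram (2 * k) (swap_halves k))}"

definition pprec :: "nat \<Rightarrow> diagram \<Rightarrow> diagram \<Rightarrow> bool" where
  "pprec k p1 p \<longleftrightarrow> kreweras k p p1 \<noteq> {}"

definition insertion :: "nat \<Rightarrow> nat list \<Rightarrow> diagram \<Rightarrow> diagram" where
  "insertion l is p =
     relabel (\<lambda>(r, j). (r, is ! j)) p \<union> {{(Top, i), (Bottom, i)} | i. i < l \<and> i \<notin> set is}"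

text \<open>
  For a list \<open>ns\<close> of sizes, \<open>block_start ns j\<close> is the first position of the \<open>j\<close>-th block of
  consecutive positions, and \<open>block_cycles ns\<close> is the product of the cyclic permutations
  \<open>s \<mapsto> s + 1 \<mapsto> \<dots>\<close> of these blocks.
\<close>

definition block_start :: "nat list \<Rightarrow> nat \<Rightarrow> nat" where
  "block_start ns j = sum_list (take j ns)"

definition block_cycles :: "nat list \<Rightarrow> nat \<Rightarrow> nat" where
  "block_cycles ns =
     foldr (\<circ>) (map (\<lambda>j. cycle_of_list [block_start ns j ..< block_start ns (Suc j)])
                 [0..<length ns]) id"

text \<open>Algebras are not required to be unital; products are those of nonempty lists.\<close>

locale complex_algebra = vector_space scale
  for scale :: "complex \<Rightarrow> 'a::ring \<Rightarrow> 'a" +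
  assumes mult_scale_left: "scale c x * y = scale c (x * y)"
    and mult_scale_right: "x * scale c y = scale c (x * y)"
begin

definition subalgebra :: "'a set \<Rightarrow> bool" where
  "subalgebra S \<longleftrightarrow> subspace S \<and> (\<forall>x\<in>S. \<forall>y\<in>S. x * y \<in> S)"

end

fun nonempty_prod :: "'a::times list \<Rightarrow> 'a" where
  "nonempty_prod (x # xs) = foldl (*) x xs"

definition multilinear_form ::
  "(complex \<Rightarrow> 'a::ab_group_add \<Rightarrow> 'a) \<Rightarrow> nat \<Rightarrow> ('a list \<Rightarrow> complex) \<Rightarrow> bool" where
  "multilinear_form scale k f \<longleftrightarrow>
     (\<forall>as i. length as = k \<longrightarrow> i < k \<longrightarrow> Vector_Spaces.linear scale (*) (\<lambda>x. f (as[i := x])))"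

text \<open>
  A family indexed by all partitions is one function on diagrams: the sets \<open>Part k\<close> are disjoint.
  The value \<open>m p as\<close> is only meaningful for \<open>p \<in> Part k\<close> and \<open>length as = k\<close>.
\<close>

locale P_tracial_algebra = complex_algebra scale
  for scale :: "complex \<Rightarrow> 'a::ring \<Rightarrow> 'a" +
  fixes m :: "diagram \<Rightarrow> 'a list \<Rightarrow> complex"
  assumes m_multilinear: "p \<in> Part k \<Longrightarrow> multilinear_form scale k (m p)"
    and m_empty: "m {} [] = 1"
    and m_perm: "\<lbrakk>p \<in> Part k; length as = k; \<sigma> permutes {..<k}\<rbrakk> \<Longrightarrow>
      m p as = m (perm_diagram k \<sigma> \<circ>\<^sub>P p \<circ>\<^sub>P perm_diagram k (inv \<sigma>)) (permute_list (inv \<sigma>) as)"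
    and m_product: "\<lbrakk>p \<in> Part k; length ass = k; [] \<notin> set ass;
        ns = map length ass; n = sum_list ns\<rbrakk> \<Longrightarrow>
      m p (map nonempty_prod ass) =
      m (insertion n (map (block_start ns) [0..<k]) p \<circ>\<^sub>P perm_diagram n (block_cycles ns))
        (concat ass)"

definition P_cumulants ::
  "(complex \<Rightarrow> 'a::ring \<Rightarrow> 'a) \<Rightarrow> (diagram \<Rightarrow> 'a list \<Rightarrow> complex) \<Rightarrow>
   (diagram \<Rightarrow> 'a list \<Rightarrow> complex) \<Rightarrow> bool" where
  "P_cumulants scale m \<kappa> \<longleftrightarrow>
     \<kappa> {} [] = 1 \<and>
     (\<forall>k. \<forall>p\<in>Part k. multilinear_form scale k (\<kappa> p)) \<and>
     (\<forall>k. \<forall>p\<in>Part k. \<forall>as. length as = k \<longrightarrow> m p as = (\<Sum>p'\<in>{p'\<in>Part k. pleq k p' p}. \<kappa> p' as))"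

lemma coarser_card:
  assumes p: "partition_on V p" and q: "partition_on V q" and fin: "finite V"
    and coarser: "\<forall>B\<in>p. \<exists>C\<in>q. B \<subseteq> C"
  shows "card q \<le> card p" and "card q = card p \<Longrightarrow> q = p"
proof -
  from coarser obtain f where f: "\<And>B. B \<in> p \<Longrightarrow> f B \<in> q \<and> B \<subseteq> f B" by metis
  have finp: "finite p" using finite_elements[OF fin p] .
  have f_eq: "f B = C" if "B \<in> p" "C \<in> q" "x \<in> B" "x \<in> C" for B C x
    using f[of B] that q by (auto simp: partition_on_def disjoint_def)
  have cover: "\<exists>B\<in>p. x \<in> B \<and> f B = C" if "C \<in> q" "x \<in> C" for C x
  proof -
    have "x \<in> \<Union>p" using partition_onD1[OF p] partition_onD1[OF q] that by auto
    then show ?thesis using f_eq that by blast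
  qed
  have img: "q = f ` p"
  proof
    show "q \<subseteq> f ` p"
    proof
      fix C assume C: "C \<in> q"
      with partition_onD3[OF q] obtain x where "x \<in> C" by (metis ex_in_conv)
      with cover[OF C] show "C \<in> f ` p" by auto
    qed
  qed (use f in auto)
  show "card q \<le> card p" unfolding img by (rule card_image_le[OF finp])
  assume "card q = card p"
  then have inj: "inj_on f p" unfolding img using finp by (simp add: eq_card_imp_inj_on)
  have "f B = B" if B: "B \<in> p" for B
  proof
    show "f B \<subseteq> B"
    proof
      fix x assume "x \<in> f B"
      then obtain B' where "B' \<in> p" "x \<in> B'" "f B' = f B"
        using cover f[OF B] by blast
      with inj B show "x \<in> B" by (auto dest: inj_onD)
    qed
  qed (use f B in auto)
  then show "q = p" using img by simp
qed

lemma finite_Part: "finite (Part k)"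
  unfolding Part_def by (rule finitely_many_partition_on) auto

lemma pdist_pos:
  assumes "p \<in> Part k" "q \<in> Part k" "p \<noteq> q"
  shows "0 < pdist p q"
proof -
  let ?V = "{Top, Bottom} \<times> {..<k}"
  have p: "partition_on ?V p" and q: "partition_on ?V q"
    using assms by (auto simp: Part_def)
  note j = pjoin_finest_common_coarsening[OF p q]
  have "\<forall>B\<in>p. \<exists>C\<in>p \<squnion>\<^sub>P q. B \<subseteq> C" using j(2) by blast
  note cp = coarser_card[OF p j(1) _ this]
  have "\<forall>B\<in>q. \<exists>C\<in>p \<squnion>\<^sub>P q. B \<subseteq> C" using j(2) by blast
  note cq = coarser_card[OF q j(1) _ this]
  have "card (p \<squnion>\<^sub>P q) \<le> card p" "card (p \<squnion>\<^sub>P q) = card p \<Longrightarrow> p \<squnion>\<^sub>P q = p"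
    using cp by simp_all
  moreover have "card (p \<squnion>\<^sub>P q) \<le> card q" "card (p \<squnion>\<^sub>P q) = card q \<Longrightarrow> p \<squnion>\<^sub>P q = q"
    using cq by simp_all
  ultimately show ?thesis using assms(3) unfolding pdist_def nc_def
    by (cases "card (p \<squnion>\<^sub>P q) = card p"; cases "card (p \<squnion>\<^sub>P q) = card q") auto
qed

lemma pdist_self:
  assumes "p \<in> Part k"
  shows "pdist p p = 0"
proof -
  let ?V = "{Top, Bottom} \<times> {..<k}"
  have p: "partition_on ?V p" using assms by (auto simp: Part_def)
  note j = pjoin_finest_common_coarsening[OF p p]
  have "\<forall>B\<in>p. \<exists>C\<in>p \<squnion>\<^sub>P p. B \<subseteq> C" using j(2) by blast
  then have "card (p \<squnion>\<^sub>P p) \<le> card p" using coarser_card(1)[OF p j(1)] by simp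
  moreover have "\<forall>C\<in>p \<squnion>\<^sub>P p. \<exists>D\<in>p. C \<subseteq> D" by (rule j(3)[OF p]) blast
  then have "card p \<le> card (p \<squnion>\<^sub>P p)" using coarser_card(1)[OF j(1) p] by simp
  ultimately show ?thesis by (simp add: pdist_def nc_def)
qed

lemma pleq_refl: "p \<in> Part k \<Longrightarrow> pleq k p p"
  by (simp add: pleq_def pdist_self)

lemma pleq_strict:
  "p \<in> Part k \<Longrightarrow> q \<in> Part k \<Longrightarrow> pleq k p q \<Longrightarrow> p \<noteq> q \<Longrightarrow>
   pdist (id_diagram k) p < pdist (id_diagram k) q"
  using pdist_pos[of p k q] by (simp add: pleq_def)

lemma sum_pleq:
  fixes f :: "diagram \<Rightarrow> complex"
  assumes p: "p \<in> Part k"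
  shows "(\<Sum>p'\<in>{p'\<in>Part k. pleq k p' p}. f p') =
    f p + (\<Sum>p'\<in>{p'\<in>Part k. p \<in> Part k \<and> pleq k p' p \<and> p' \<noteq> p}. f p')"
proof -
  have "{p'\<in>Part k. pleq k p' p} = insert p {p'\<in>Part k. p \<in> Part k \<and> pleq k p' p \<and> p' \<noteq> p}"
    using p pleq_refl by auto
  then show ?thesis by (simp add: finite_Part)
qed

function cumulant ::
  "(diagram \<Rightarrow> 'a list \<Rightarrow> complex) \<Rightarrow> nat \<Rightarrow> diagram \<Rightarrow> 'a list \<Rightarrow> complex" where
  "cumulant m k p as =
     m p as - (\<Sum>p'\<in>{p'\<in>Part k. p \<in> Part k \<and> pleq k p' p \<and> p' \<noteq> p}. cumulant m k p' as)"
  by pat_completeness auto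
termination
proof (relation "measure (\<lambda>(m, k, p, as). card {q\<in>Part k. pdist (id_diagram k) q < pdist (id_diagram k) p})")
  fix m :: "diagram \<Rightarrow> 'a list \<Rightarrow> complex" and k p and as :: "'a list" and p'
  assume "p' \<in> {p'\<in>Part k. p \<in> Part k \<and> pleq k p' p \<and> p' \<noteq> p}"
  then have *: "p' \<in> Part k" "pdist (id_diagram k) p' < pdist (id_diagram k) p"
    using pleq_strict by auto
  have "{q\<in>Part k. pdist (id_diagram k) q < pdist (id_diagram k) p'} \<subset>
        {q\<in>Part k. pdist (id_diagram k) q < pdist (id_diagram k) p}"
    using * by auto
  then show "((m, k, p', as), (m, k, p, as)) \<in>
    measure (\<lambda>(m, k, p, as). card {q\<in>Part k. pdist (id_diagram k) q < pdist (id_diagram k) p})"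
    by (auto intro!: psubset_card_mono simp: finite_Part)
qed simp

declare cumulant.simps [simp del]

lemma cumulant_sum:
  assumes p: "p \<in> Part k"
  shows "m p as = (\<Sum>p'\<in>{p'\<in>Part k. pleq k p' p}. cumulant m k p' as)"
  unfolding sum_pleq[OF p] by (subst cumulant.simps) simp

lemma cumulant_linear:
  assumes m: "\<And>p. p \<in> Part k \<Longrightarrow> multilinear_form scale k (m p)"
    and as: "length as = k" "i < k" and p: "p \<in> Part k"
  shows "Vector_Spaces.linear scale (*) (\<lambda>x. cumulant m k p (as[i := x]))"
  using p
proof (induction "card {q\<in>Part k. pdist (id_diagram k) q < pdist (id_diagram k) p}"
    arbitrary: p rule: less_induct)
  case less
  let ?S = "{p'\<in>Part k. p \<in> Part k \<and> pleq k p' p \<and> p' \<noteq> p}"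
  have lm: "Vector_Spaces.linear scale (*) (\<lambda>x. m p (as[i := x]))"
    using m[OF less.prems] as by (auto simp: multilinear_form_def)
  then interpret Vector_Spaces.linear scale "(*)" "\<lambda>x. m p (as[i := x])" .
  interpret vector_space_pair scale "(*) :: complex \<Rightarrow> complex \<Rightarrow> complex" ..
  have "Vector_Spaces.linear scale (*) (\<lambda>x. cumulant m k p' (as[i := x]))" if "p' \<in> ?S" for p'
  proof (rule less.hyps)
    show "p' \<in> Part k" using that by simp
    then have "{q\<in>Part k. pdist (id_diagram k) q < pdist (id_diagram k) p'} \<subset>
        {q\<in>Part k. pdist (id_diagram k) q < pdist (id_diagram k) p}"
      using pleq_strict[of p' k p] that by auto
    then show "card {q\<in>Part k. pdist (id_diagram k) q < pdist (id_diagram k) p'} <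
        card {q\<in>Part k. pdist (id_diagram k) q < pdist (id_diagram k) p}"
      by (auto intro!: psubset_card_mono simp: finite_Part)
  qed
  then have "Vector_Spaces.linear scale (*) (\<lambda>x. \<Sum>p'\<in>?S. cumulant m k p' (as[i := x]))"
    by (intro linear_compose_sum) auto
  from linear_compose_sub[OF lm this] show ?case
    by (subst cumulant.simps)
qed

lemma Part_0: "Part 0 = {{}}"
  by (simp add: Part_def partition_on_empty)

lemma P_cumulants_exist:
  assumes "P_tracial_algebra scale m"
  shows "\<exists>\<kappa>. P_cumulants scale m \<kappa>"
proof
  interpret P_tracial_algebra scale m by fact
  let ?\<kappa> = "\<lambda>p as. cumulant m (length as) p as"
  have "multilinear_form scale k (?\<kappa> p)" if "p \<in> Part k" for k p
    using cumulant_linear[OF m_multilinear _ _ that] by (auto simp: multilinear_form_def)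
  moreover have "?\<kappa> {} [] = 1"
    using m_empty by (subst cumulant.simps) (auto simp: Part_0 intro!: sum.neutral)
  ultimately show "P_cumulants scale m ?\<kappa>"
    using cumulant_sum by (auto simp: P_cumulants_def)
qed

lemma P_cumulants_unique:
  assumes \<kappa>: "P_cumulants scale m \<kappa>" and "P_cumulants scale m \<kappa>'"
    and "p \<in> Part k" "length as = k"
  shows "\<kappa> p as = \<kappa>' p as"
proof -
  have "f p as = cumulant m k p as" if f: "P_cumulants scale m f" for f
    using assms(3)
  proof (induction "card {q\<in>Part k. pdist (id_diagram k) q < pdist (id_diagram k) p}"
      arbitrary: p rule: less_induct)
    case less
    let ?S = "{p'\<in>Part k. p \<in> Part k \<and> pleq k p' p \<and> p' \<noteq> p}"
    have IH: "f p' as = cumulant m k p' as" if "p' \<in> ?S" for p'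
    proof (rule less.hyps)
      show "p' \<in> Part k" using that by simp
      then have "{q\<in>Part k. pdist (id_diagram k) q < pdist (id_diagram k) p'} \<subset>
          {q\<in>Part k. pdist (id_diagram k) q < pdist (id_diagram k) p}"
        using pleq_strict[of p' k p] that by auto
      then show "card {q\<in>Part k. pdist (id_diagram k) q < pdist (id_diagram k) p'} <
          card {q\<in>Part k. pdist (id_diagram k) q < pdist (id_diagram k) p}"
        by (auto intro!: psubset_card_mono simp: finite_Part)
    qed
    have "m p as = (\<Sum>p'\<in>{p'\<in>Part k. pleq k p' p}. f p' as)"
      using f less.prems assms(4) by (simp add: P_cumulants_def)
    also have "\<dots> = f p as + (\<Sum>p'\<in>?S. f p' as)"
      by (rule sum_pleq[OF less.prems])
    also have "(\<Sum>p'\<in>?S. f p' as) = (\<Sum>p'\<in>?S. cumulant m k p' as)"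
      by (rule sum.cong) (use IH in auto)
    finally show ?case by (subst cumulant.simps) simp
  qed
  with assms(1,2) show ?thesis by metis
qed

definition P_free ::
  "(diagram \<Rightarrow> 'a list \<Rightarrow> complex) \<Rightarrow> 'a set \<Rightarrow> 'a set \<Rightarrow> bool" where
  "P_free \<kappa> A1 A2 \<longleftrightarrow>
     (\<forall>k p as (\<epsilon> :: nat \<Rightarrow> nat).
        p \<in> Part k \<longrightarrow> length as = k \<longrightarrow>
        (\<forall>i<k. \<epsilon> i \<in> {1, 2} \<and> as ! i \<in> (if \<epsilon> i = 1 then A1 else A2)) \<longrightarrow>
        (\<exists>C\<in>cycles k p. \<exists>i<k. \<exists>j<k. (Top, i) \<in> C \<and> (Top, j) \<in> C \<and> \<epsilon> i \<noteq> \<epsilon> j) \<longrightarrow>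
        \<kappa> p as = 0) \<and>
     (\<forall>k1 k2 p1 p2 as bs.
        p1 \<in> Part k1 \<longrightarrow> p2 \<in> Part k2 \<longrightarrow> length as = k1 \<longrightarrow> length bs = k2 \<longrightarrow>
        set as \<subseteq> A1 \<longrightarrow> set bs \<subseteq> A2 \<longrightarrow>
        \<kappa> (ptensor k1 p1 p2) (as @ bs) = \<kappa> p1 as * \<kappa> p2 bs)"

end

theory Submission
  imports Defs
begin

text \<open>
  All three formulas come from counting connected components, because the order on diagrams is
  defined by numbers of blocks.  Write \<open>N F\<close> for the number of components of a family \<open>F\<close> of sets.  For
  diagrams on \<open>k\<close> columns, \<open>p \<le> q\<close> is the equality case of the triangle inequality
  \<open>N (p \<union> id) + N (p \<union> q) \<le> N p + N (q \<union> id)\<close>, which follows from the submodularity of \<open>N\<close>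
  (\<open>ncomp_triangle\<close>, \<open>pleq_iff\<close>).

  Products.  The axioms of a tracial algebra give \<open>m p (a\<^sub>1 b\<^sub>1, \<dots>, a\<^sub>k b\<^sub>k) = m (twist k p) (a, b)\<close> with
  \<open>twist k p = (p \<otimes> id) \<circ> \<tau>\<close>.  Expanding into cumulants, freeness only leaves the tensor products below
  the twist, so the moment is the sum of \<open>\<kappa> p1 a * \<kappa> p2 b\<close> over all \<open>p1 \<otimes> p2 \<le> twist k p\<close>
  (\<open>moment_product_free\<close>).  This condition on \<open>2k\<close> columns is again the equality case of a triangle
  inequality; contracting the edges of the twist expresses it by the three diagrams \<open>p2\<close>, \<open>p1\<close> and
  \<open>p\<close> on the three rows of the composition \<open>p1 \<circ> p2\<close>.  Erasing one of the rows, while keeping track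
  of the components lost, writes this inequality as a sum of two triangle inequalities on fewer rows, in two
  ways:
  \<^item> \<open>p1 \<otimes> p2 \<le> twist k p\<close> iff \<open>p1 \<le> p\<close> and \<open>p2 \<le> flip p1 \<circ> p\<close> (\<open>pleq_twist_flip\<close>);
  \<^item> \<open>p1 \<otimes> p2 \<le> twist k p\<close> iff \<open>p1 \<circ> p2 \<le> p\<close> and \<open>p1 \<otimes> p2 \<le> twist k (p1 \<circ> p2)\<close>
    (\<open>pleq_twist_pcomp\<close>).

  By the first equivalence the inner sum over \<open>p2\<close> is the moment of \<open>flip p1 \<circ> p\<close>, which is the
  formula for \<open>m p\<close>.  The second one says that \<open>p2\<close> belongs to the Kreweras complement of \<open>p1\<close> in
  \<open>p' = p1 \<circ> p2\<close>, and that the admissible pairs are sorted by \<open>p' \<le> p\<close>.  Hence the proposed cumulants of the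
  product have the right sums over lower sets, and these sums determine them (\<open>moebius_unique\<close>).

  Sums.  A cumulant of \<open>a + b\<close> expands multilinearly over the sets \<open>I\<close> of columns that receive a letter of
  \<open>a\<close>.  By freeness only unions \<open>I\<close> of cycles contribute, and these correspond to the factorizations
  of \<open>p\<close>; permutation invariance of the cumulants brings the columns of \<open>I\<close> to the front, where freeness
  factorizes the cumulant (\<open>cumulant_sum_of_free\<close>).
\<close>

section \<open>Connected components of a family of sets\<close>

definition linked :: "'v set set \<Rightarrow> ('v \<times> 'v) set" where
  "linked F = (\<Union>B\<in>F. B \<times> B)\<^sup>+"

lemma components_linked: "components F = \<Union>F // linked F"
  by (simp add: components_def linked_def)

lemma equiv_linked: "equiv (\<Union>F) (linked F)"
  unfolding linked_def by (rule equiv_components)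

lemma linkedI: "B \<in> F \<Longrightarrow> x \<in> B \<Longrightarrow> y \<in> B \<Longrightarrow> (x, y) \<in> linked F"
  unfolding linked_def by (rule r_into_trancl) auto

lemma linked_refl: "x \<in> \<Union>F \<Longrightarrow> (x, x) \<in> linked F"
  by (auto intro: linkedI)

lemma linked_sym: "(x, y) \<in> linked F \<Longrightarrow> (y, x) \<in> linked F"
  using equiv_linked[of F] by (auto elim: equivE dest: symD)

lemma linked_trans: "(x, y) \<in> linked F \<Longrightarrow> (y, z) \<in> linked F \<Longrightarrow> (x, z) \<in> linked F"
  unfolding linked_def by (rule trancl_trans)

lemma linked_field: "(x, y) \<in> linked F \<Longrightarrow> x \<in> \<Union>F \<and> y \<in> \<Union>F"
  using equiv_linked[of F] by (auto elim: equivE)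

lemma linked_map:
  assumes step: "\<And>B x y. B \<in> F \<Longrightarrow> x \<in> B \<Longrightarrow> y \<in> B \<Longrightarrow> (f x, f y) \<in> linked G"
    and xy: "(x, y) \<in> linked F"
  shows "(f x, f y) \<in> linked G"
  using xy unfolding linked_def[of F]
proof (induction rule: trancl_induct)
  case (base y)
  then show ?case using step by blast
next
  case (step y z)
  then show ?case using assms(1) linked_trans by (metis (no_types, lifting) SigmaE2 UN_E)
qed

lemma linked_map_image: "(x, y) \<in> linked F \<Longrightarrow> (f x, f y) \<in> linked ((`) f ` F)"
  by (rule linked_map[of F f, rotated]) (auto intro: linkedI)

lemma linked_refl_iff: "(x, x) \<in> linked F \<longleftrightarrow> x \<in> \<Union>F"
  using linked_refl[of x F] linked_field[of x x F] by auto

lemma linked_subset: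
  assumes "\<And>B x y. B \<in> F \<Longrightarrow> x \<in> B \<Longrightarrow> y \<in> B \<Longrightarrow> (x, y) \<in> linked G"
  shows "linked F \<subseteq> linked G"
  using linked_map[of F id G] assms by auto

lemma linked_mono: "F \<subseteq> G \<Longrightarrow> linked F \<subseteq> linked G"
  by (rule linked_subset) (auto intro: linkedI)

lemma components_eqI:
  assumes "linked F = linked G"
  shows "components F = components G"
proof -
  have "\<Union>F = Domain (linked F)" for F :: "'a set set"
    using linked_refl linked_field by fastforce
  then show ?thesis using assms by (simp add: components_linked)
qed

lemma partition_block_unique:
  "partition_on V p \<Longrightarrow> B \<in> p \<Longrightarrow> C \<in> p \<Longrightarrow> x \<in> B \<Longrightarrow> x \<in> C \<Longrightarrow> B = C"
  using disjointD[of p B C] by (auto dest: partition_onD2)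

lemma linked_of_partition:
  assumes p: "partition_on V p"
  shows "(x, y) \<in> linked p \<longleftrightarrow> (\<exists>B\<in>p. x \<in> B \<and> y \<in> B)"
proof
  assume "(x, y) \<in> linked p"
  then show "\<exists>B\<in>p. x \<in> B \<and> y \<in> B"
    unfolding linked_def
  proof (induction rule: trancl_induct)
    case (step y z)
    then obtain B C where "B \<in> p" "x \<in> B" "y \<in> B" "C \<in> p" "y \<in> C" "z \<in> C" by auto
    then show ?case using partition_block_unique[OF p] by metis
  qed auto
qed (auto intro: linkedI)

lemma mem_components:
  assumes "C \<in> components F" "x \<in> C"
  shows "y \<in> C \<longleftrightarrow> (x, y) \<in> linked F"
proof -
  obtain z where z: "C = linked F `` {z}"
    using assms(1) unfolding components_linked by (elim quotientE)
  then show ?thesis using assms(2) linked_sym linked_trans by (metis Image_singleton_iff)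
qed

text \<open>
  The components contain the same connections as the family they come from, so any subfamily may be
  replaced by its components when further sets are added; the counting lemmas below rest on this.
\<close>

lemma linked_components: "linked (components F) = linked F"
proof (intro equalityI subrelI)
  fix x y assume "(x, y) \<in> linked (components F)"
  then show "(x, y) \<in> linked F"
    using linked_of_partition[OF partition_on_components] mem_components by metis
next
  fix x y assume xy: "(x, y) \<in> linked F"
  then have "linked F `` {x} \<in> components F"
    using linked_field unfolding components_linked by (metis quotientI)
  moreover have "x \<in> linked F `` {x}" "y \<in> linked F `` {x}"
    using xy linked_field linked_refl by fastforce+
  ultimately show "(x, y) \<in> linked (components F)" by (rule linkedI)
qed

lemma linked_Un_cong:
  assumes "linked F = linked F'"
  shows "linked (F \<union> G) = linked (F' \<union> G)"
proof -
  have "linked (F \<union> G) \<subseteq> linked (F' \<union> G)" if "linked F = linked F'" for F F' :: "'a set set"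
  proof (rule linked_subset)
    fix B x y assume B: "B \<in> F \<union> G" "x \<in> B" "y \<in> B"
    show "(x, y) \<in> linked (F' \<union> G)"
    proof (cases "B \<in> F")
      case True
      then have "(x, y) \<in> linked F'" using B that linkedI[of B F] by auto
      then show ?thesis using linked_mono[of F' "F' \<union> G"] by auto
    next
      case False
      then show ?thesis using B by (auto intro: linkedI)
    qed
  qed
  then show ?thesis using assms by auto
qed

lemma components_of_partition:
  assumes p: "partition_on V p"
  shows "components p = p"
proof (rule set_eqI)
  have eq: "linked p `` {x} = B" if "B \<in> p" "x \<in> B" for B x
  proof -
    have "y \<in> linked p `` {x} \<longleftrightarrow> y \<in> B" for y
    proof
      assume "y \<in> linked p `` {x}"
      then obtain C where "C \<in> p" "x \<in> C" "y \<in> C" by (auto simp: linked_of_partition[OF p])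
      then show "y \<in> B" using partition_block_unique[OF p, of B C x] that by simp
    qed (use that in \<open>auto intro: linkedI\<close>)
    then show ?thesis by blast
  qed
  fix B
  show "B \<in> components p \<longleftrightarrow> B \<in> p"
  proof
    assume "B \<in> components p"
    then show "B \<in> p" unfolding components_linked by (elim quotientE UnionE) (simp add: eq)
  next
    assume B: "B \<in> p"
    then obtain x where "x \<in> B" using partition_onD3[OF p] by (metis ex_in_conv)
    then show "B \<in> components p"
      unfolding components_linked using eq[OF B] B by (metis UnionI quotientI)
  qed
qed

lemma components_absorb:
  assumes "\<And>B x y. B \<in> G \<Longrightarrow> x \<in> B \<Longrightarrow> y \<in> B \<Longrightarrow> (x, y) \<in> linked F"
  shows "components (F \<union> G) = components F"
proof (rule components_eqI, rule equalityI)
  show "linked (F \<union> G) \<subseteq> linked F"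
  proof (rule linked_subset)
    fix B x y assume "B \<in> F \<union> G" "x \<in> B" "y \<in> B"
    then show "(x, y) \<in> linked F" using assms[of B x y] linkedI[of B F x y] by blast
  qed
qed (simp add: linked_mono)

section \<open>Counting components\<close>

definition ncomp :: "'v set set \<Rightarrow> nat" where
  "ncomp F = card (components F)"

lemma ncomp_partition: "partition_on V p \<Longrightarrow> ncomp p = card p"
  by (simp add: ncomp_def components_of_partition)

lemma ncomp_cong_linked: "linked F = linked G \<Longrightarrow> ncomp F = ncomp G"
  unfolding ncomp_def using components_eqI by metis

text \<open>
  Identifying points that are already connected does not change the number of components: the map
  on components induced by \<open>f\<close> is onto, and it is injective because the connections downstairs
  lift along a section of \<open>f\<close>.
\<close>

lemma ncomp_contract:
  assumes ker: "\<And>x y. x \<in> \<Union>F \<Longrightarrow> y \<in> \<Union>F \<Longrightarrow> f x = f y \<Longrightarrow> (x, y) \<in> linked F"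
  shows "ncomp ((`) f ` F) = ncomp F"
proof -
  define g where "g w = (SOME x. x \<in> \<Union>F \<and> f x = w)" for w
  have g: "(g (f x), x) \<in> linked F" if "x \<in> \<Union>F" for x
  proof -
    have "g (f x) \<in> \<Union>F \<and> f (g (f x)) = f x"
      unfolding g_def by (rule someI[of _ x]) (use that in auto)
    then show ?thesis using ker that by auto
  qed
  have iff: "(f x, f y) \<in> linked ((`) f ` F) \<longleftrightarrow> (x, y) \<in> linked F"
    if xy: "x \<in> \<Union>F" "y \<in> \<Union>F" for x y
  proof
    assume "(f x, f y) \<in> linked ((`) f ` F)"
    then have "(g (f x), g (f y)) \<in> linked F"
    proof (rule linked_map[rotated])
      fix B v w assume "B \<in> (`) f ` F" "v \<in> B" "w \<in> B"
      then obtain C x y where C: "C \<in> F" "x \<in> C" "y \<in> C" "v = f x" "w = f y" by auto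
      have "(g v, x) \<in> linked F" "(g w, y) \<in> linked F" using C g[of x] g[of y] by auto
      moreover have "(x, y) \<in> linked F" using C by (auto intro: linkedI)
      ultimately show "(g v, g w) \<in> linked F" by (blast intro: linked_sym linked_trans)
    qed
    then show "(x, y) \<in> linked F"
      using linked_sym[OF g[OF xy(1)]] g[OF xy(2)] by (blast intro: linked_trans)
  next
    assume "(x, y) \<in> linked F"
    then show "(f x, f y) \<in> linked ((`) f ` F)" by (rule linked_map_image)
  qed
  have im: "f ` (linked F `` {x}) = linked ((`) f ` F) `` {f x}" if x: "x \<in> \<Union>F" for x
  proof (rule set_eqI)
    fix w
    have "w \<in> linked ((`) f ` F) `` {f x} \<longleftrightarrow> (\<exists>y\<in>\<Union>F. w = f y \<and> (f x, f y) \<in> linked ((`) f ` F))"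
      using linked_field[of "f x" w "(`) f ` F"] by auto
    also have "\<dots> \<longleftrightarrow> (\<exists>y\<in>\<Union>F. w = f y \<and> (x, y) \<in> linked F)"
      using iff[OF x] by auto
    also have "\<dots> \<longleftrightarrow> w \<in> f ` (linked F `` {x})" using linked_field[of x _ F] by auto
    finally show "w \<in> f ` (linked F `` {x}) \<longleftrightarrow> w \<in> linked ((`) f ` F) `` {f x}" by simp
  qed
  have "components ((`) f ` F) = (`) f ` components F"
  proof (intro set_eqI iffI)
    fix D assume "D \<in> components ((`) f ` F)"
    then obtain x where "x \<in> \<Union>F" "D = linked ((`) f ` F) `` {f x}"
      unfolding components_linked by (elim quotientE) auto
    then show "D \<in> (`) f ` components F"
      unfolding components_linked using im quotientI[of x "\<Union>F" "linked F"] by (metis imageI)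
  next
    fix D assume "D \<in> (`) f ` components F"
    then obtain C where C: "C \<in> components F" "D = f ` C" by auto
    then obtain x where x: "x \<in> \<Union>F" "C = linked F `` {x}"
      unfolding components_linked by (elim quotientE)
    then have "D = linked ((`) f ` F) `` {f x}" "f x \<in> \<Union>((`) f ` F)"
      using C(2) im by auto
    then show "D \<in> components ((`) f ` F)"
      unfolding components_linked using quotientI by metis
  qed
  moreover have "inj_on ((`) f) (components F)"
  proof (rule inj_onI)
    fix C D assume CD: "C \<in> components F" "D \<in> components F" "f ` C = f ` D"
    obtain x where x: "x \<in> \<Union>F" "C = linked F `` {x}"
      using CD(1) unfolding components_linked by (elim quotientE)
    obtain y where y: "y \<in> \<Union>F" "D = linked F `` {y}"
      using CD(2) unfolding components_linked by (elim quotientE)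
    have "f x \<in> f ` C" using x(2) linked_refl[OF x(1)] by auto
    then have "(f y, f x) \<in> linked ((`) f ` F)" unfolding CD(3) y(2) im[OF y(1)] by simp
    then have "(y, x) \<in> linked F" using iff x(1) y(1) by simp
    from equiv_class_eq[OF equiv_linked this] show "C = D" by (simp add: x(2) y(2))
  qed
  ultimately show ?thesis unfolding ncomp_def by (simp add: card_image)
qed

lemma ncomp_inj: "inj_on f (\<Union>F) \<Longrightarrow> ncomp ((`) f ` F) = ncomp F"
  by (rule ncomp_contract) (auto dest!: inj_onD intro: linkedI)

lemma linked_disjoint:
  assumes disj: "\<Union>F \<inter> \<Union>G = {}"
  shows "linked (F \<union> G) = linked F \<union> linked G"
proof
  show "linked (F \<union> G) \<subseteq> linked F \<union> linked G"
  proof (rule subrelI)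
    fix x y assume "(x, y) \<in> linked (F \<union> G)"
    then show "(x, y) \<in> linked F \<union> linked G"
      unfolding linked_def[of "F \<union> G"]
    proof (induction rule: trancl_induct)
      case (base y)
      then show ?case by (auto intro: linkedI)
    next
      case (step y z)
      then obtain B where B: "B \<in> F \<union> G" "y \<in> B" "z \<in> B" by auto
      from step.IH have "(x, y) \<in> linked F \<or> (x, y) \<in> linked G" by simp
      then show ?case
      proof
        assume xy: "(x, y) \<in> linked F"
        then have "B \<in> F" using B disj linked_field[OF xy] by auto
        then have "(y, z) \<in> linked F" using B by (auto intro: linkedI)
        then show ?thesis using linked_trans[OF xy] by simp
      next
        assume xy: "(x, y) \<in> linked G"
        then have "B \<in> G" using B disj linked_field[OF xy] by auto
        then have "(y, z) \<in> linked G" using B by (auto intro: linkedI)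
        then show ?thesis using linked_trans[OF xy] by simp
      qed
    qed
  qed
qed (simp add: linked_mono)

lemma ncomp_disjoint:
  assumes disj: "\<Union>F \<inter> \<Union>G = {}" and fin: "finite (\<Union>F)" "finite (\<Union>G)"
  shows "ncomp (F \<union> G) = ncomp F + ncomp G"
proof -
  have F: "partition_on (\<Union>F) (components F)" and G: "partition_on (\<Union>G) (components G)"
    by (rule partition_on_components)+
  have "linked (F \<union> G) = linked (components F \<union> components G)"
    using disj partition_onD1[OF F] partition_onD1[OF G]
    by (simp add: linked_disjoint linked_components)
  moreover have "partition_on (\<Union>F \<union> \<Union>G) (components F \<union> components G)"
    using F G disj disjoint_union[of "components F" "components G"] unfolding partition_on_def by simp
  ultimately have "components (F \<union> G) = components F \<union> components G"
    by (simp add: components_eqI[of "F \<union> G" "components F \<union> components G"] components_of_partition)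
  moreover have "components F \<inter> components G = {}"
  proof (rule equals0I)
    fix C assume C: "C \<in> components F \<inter> components G"
    then obtain x where "x \<in> C" using partition_onD3[OF F] by (metis IntD1 ex_in_conv)
    then show False using C disj partition_onD1[OF F] partition_onD1[OF G] by blast
  qed
  moreover have "finite (components F)" "finite (components G)"
    using finite_elements[OF fin(1) F] finite_elements[OF fin(2) G] .
  ultimately show ?thesis unfolding ncomp_def by (simp add: card_Un_disjoint)
qed

text \<open>
  Erasing the points outside \<open>V\<close> after taking components loses exactly the components that
  miss \<open>V\<close>.  For the others, every point is pushed to a connected point of \<open>V\<close>, which is a
  contraction; sets \<open>G\<close> living in \<open>V\<close> are not moved and can be added before or after erasing.
  With \<open>V\<close> the two outer rows of a stack of diagrams, this compares a stack with its composition.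
\<close>

lemma ncomp_erase:
  assumes fin: "finite (\<Union>F)" and G: "\<Union>G \<subseteq> V \<inter> \<Union>F"
  shows "ncomp (F \<union> G) = ncomp (((\<lambda>B. B \<inter> V) ` components F - {{}}) \<union> G)
      + card {C \<in> components F. C \<inter> V = {}}"
proof -
  define F0 where "F0 = {C \<in> components F. C \<inter> V = {}}"
  define F1 where "F1 = {C \<in> components F. C \<inter> V \<noteq> {}}"
  have part: "partition_on (\<Union>F) (components F)" by (rule partition_on_components)
  have split: "components F = F1 \<union> F0" by (auto simp: F0_def F1_def)
  have UF: "\<Union>F = \<Union>(components F)" using partition_onD1[OF part] .
  have disj: "\<Union>F1 \<inter> \<Union>F0 = {}"
  proof -
    have False if "B \<in> F1" "C \<in> F0" "x \<in> B" "x \<in> C" for B C x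
      using partition_block_unique[OF part, of B C x] that by (auto simp: F0_def F1_def)
    then show ?thesis by blast
  qed
  have GF1: "\<Union>G \<subseteq> \<Union>F1" using G unfolding UF F1_def by blast
  have p0: "partition_on (\<Union>F0) F0"
    using part unfolding partition_on_def F0_def by (auto simp: disjoint_def)
  have p1: "partition_on (\<Union>F1) F1"
    using part unfolding partition_on_def F1_def by (auto simp: disjoint_def)
  have "ncomp (F \<union> G) = ncomp (components F \<union> G)"
    by (rule ncomp_cong_linked, rule linked_Un_cong) (simp add: linked_components)
  also have "components F \<union> G = (F1 \<union> G) \<union> F0" using split by auto
  also have "ncomp \<dots> = ncomp (F1 \<union> G) + ncomp F0"
  proof (rule ncomp_disjoint)
    show "\<Union>(F1 \<union> G) \<inter> \<Union>F0 = {}" using disj GF1 by blast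
    show "finite (\<Union>(F1 \<union> G))" "finite (\<Union>F0)"
      by (rule finite_subset[OF _ fin], use GF1 UF split in auto)+
  qed
  also have "ncomp F0 = card F0" by (rule ncomp_partition[OF p0])
  also have "ncomp (F1 \<union> G) = ncomp (((\<lambda>B. B \<inter> V) ` components F - {{}}) \<union> G)"
  proof -
    define g where "g x = (if x \<in> V then x else SOME y. y \<in> V \<and> (x, y) \<in> linked F1)" for x
    have g: "g x \<in> V \<and> (x, g x) \<in> linked F1" if x: "x \<in> \<Union>F1" for x
    proof (cases "x \<in> V")
      case True
      then show ?thesis using x by (simp add: g_def linked_refl)
    next
      case False
      obtain B y where "B \<in> F1" "x \<in> B" "y \<in> B" "y \<in> V" using x by (auto simp: F1_def)
      then have "y \<in> V \<and> (x, y) \<in> linked F1" by (auto intro: linkedI)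
      from someI[of "\<lambda>y. y \<in> V \<and> (x, y) \<in> linked F1", OF this] False show ?thesis
        by (simp add: g_def)
    qed
    have gB: "g ` B = B \<inter> V" if B: "B \<in> F1" for B
    proof
      show "g ` B \<subseteq> B \<inter> V"
      proof
        fix w assume "w \<in> g ` B"
        then obtain x where x: "x \<in> B" "w = g x" by auto
        then have "w \<in> V" "(x, w) \<in> linked F1" using g B by auto
        then obtain B' where "B' \<in> F1" "x \<in> B'" "w \<in> B'"
          using linked_of_partition[OF p1] by auto
        then have "w \<in> B" using x B partition_block_unique[OF p1] by metis
        then show "w \<in> B \<inter> V" using \<open>w \<in> V\<close> by simp
      qed
      show "B \<inter> V \<subseteq> g ` B" by (auto simp: g_def image_iff)
    qed
    have gG: "g ` B = B" if "B \<in> G" for B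
    proof -
      have "B \<subseteq> V" using that G by auto
      then have "g x = x" if "x \<in> B" for x using that by (auto simp: g_def)
      then show ?thesis by auto
    qed
    have "ncomp (F1 \<union> G) = ncomp ((`) g ` (F1 \<union> G))"
    proof (rule ncomp_contract[symmetric])
      fix x y assume "x \<in> \<Union>(F1 \<union> G)" "y \<in> \<Union>(F1 \<union> G)" and eq: "g x = g y"
      then have "x \<in> \<Union>F1" "y \<in> \<Union>F1" using GF1 by auto
      then have "(x, g x) \<in> linked F1" "(y, g y) \<in> linked F1" using g by auto
      then have "(x, y) \<in> linked F1" using eq linked_trans[OF _ linked_sym] by metis
      then show "(x, y) \<in> linked (F1 \<union> G)" using linked_mono[of F1 "F1 \<union> G"] by auto
    qed
    also have "(`) g ` (F1 \<union> G) = ((\<lambda>B. B \<inter> V) ` components F - {{}}) \<union> G"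
    proof -
      have "(`) g ` F1 = (\<lambda>B. B \<inter> V) ` F1" using gB by (intro image_cong) auto
      also have "\<dots> = (\<lambda>B. B \<inter> V) ` components F - {{}}" by (auto simp: F1_def)
      finally have "(`) g ` F1 = (\<lambda>B. B \<inter> V) ` components F - {{}}" .
      moreover have "(`) g ` G = G" using gG by simp
      ultimately show ?thesis by (simp add: image_Un)
    qed
    finally show ?thesis .
  qed
  finally show ?thesis by (simp add: F0_def)
qed

text \<open>
  If every point is connected to its image under a retraction onto \<open>V\<close>, erasing the points outside
  \<open>V\<close> amounts to applying the retraction.  This computes the compositions with permutations, where
  each middle point is tied to a single outer point.
\<close>

lemma restrict_components_retract:
  assumes id: "\<And>x. x \<in> V \<Longrightarrow> g x = x" and gV: "\<And>x. x \<in> \<Union>F \<Longrightarrow> g x \<in> V"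
    and lk: "\<And>x. x \<in> \<Union>F \<Longrightarrow> (x, g x) \<in> linked F"
  shows "(\<lambda>B. B \<inter> V) ` components F - {{}} = components ((`) g ` F)"
proof -
  have 1: "(x, y) \<in> linked ((`) g ` F) \<longleftrightarrow> (x, y) \<in> linked F \<and> x \<in> V \<and> y \<in> V" for x y
  proof
    assume xy: "(x, y) \<in> linked ((`) g ` F)"
    then have "x \<in> V" "y \<in> V" using linked_field[OF xy] gV by auto
    moreover have "linked ((`) g ` F) \<subseteq> linked F"
    proof (rule linked_subset)
      fix B v w assume "B \<in> (`) g ` F" "v \<in> B" "w \<in> B"
      then obtain C x y where "C \<in> F" "x \<in> C" "y \<in> C" "v = g x" "w = g y" by auto
      then have "(x, v) \<in> linked F" "(x, y) \<in> linked F" "(y, w) \<in> linked F"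
        using lk by (auto intro: linkedI)
      then show "(v, w) \<in> linked F" by (blast intro: linked_sym linked_trans)
    qed
    ultimately show "(x, y) \<in> linked F \<and> x \<in> V \<and> y \<in> V" using xy by auto
  next
    assume xy: "(x, y) \<in> linked F \<and> x \<in> V \<and> y \<in> V"
    then have "(g x, g y) \<in> linked ((`) g ` F)"
      by (intro linked_map_image) simp
    then show "(x, y) \<in> linked ((`) g ` F)" using xy by (simp add: id)
  qed
  have U: "\<Union>((`) g ` F) = V \<inter> \<Union>F"
  proof -
    have "x \<in> \<Union>((`) g ` F) \<longleftrightarrow> x \<in> V \<inter> \<Union>F" for x
      using 1[of x x] unfolding linked_refl_iff by blast
    then show ?thesis by blast
  qed
  show ?thesis
  proof (rule set_eqI)
    fix B
    show "B \<in> (\<lambda>B. B \<inter> V) ` components F - {{}} \<longleftrightarrow> B \<in> components ((`) g ` F)"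
    proof
      assume "B \<in> (\<lambda>B. B \<inter> V) ` components F - {{}}"
      then obtain C x where C: "C \<in> components F" "B = C \<inter> V" "x \<in> C" "x \<in> V" by auto
      then have "x \<in> \<Union>F" using partition_onD1[OF partition_on_components, of F] by auto
      have "B = linked ((`) g ` F) `` {x}" unfolding C(2) using mem_components[OF C(1,3)] C(4) 1 by auto
      moreover have "x \<in> \<Union>((`) g ` F)" using U C \<open>x \<in> \<Union>F\<close> by blast
      ultimately show "B \<in> components ((`) g ` F)" unfolding components_linked by (metis quotientI)
    next
      assume "B \<in> components ((`) g ` F)"
      then obtain x where x: "x \<in> \<Union>((`) g ` F)" "B = linked ((`) g ` F) `` {x}"
        unfolding components_linked by (elim quotientE)
      then have xV: "x \<in> V" "x \<in> \<Union>F" using U by auto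
      have "B = linked F `` {x} \<inter> V" using x(2) xV 1 by auto
      moreover have "linked F `` {x} \<in> components F" unfolding components_linked
        using xV by (metis quotientI)
      moreover have "x \<in> B" using x by (simp add: linked_refl_iff)
      ultimately show "B \<in> (\<lambda>B. B \<inter> V) ` components F - {{}}" by auto
    qed
  qed
qed

lemma ncomp_insert_edge:
  assumes fin: "finite (\<Union>F)" and xy: "x \<in> \<Union>F" "y \<in> \<Union>F"
  shows "ncomp F = ncomp (insert {x, y} F) + (if (x, y) \<in> linked F then 0 else 1)"
proof (cases "(x, y) \<in> linked F")
  case True
  have "components (F \<union> {{x, y}}) = components F"
    by (rule components_absorb)
      (use True linked_sym[OF True] linked_refl[OF xy(1)] linked_refl[OF xy(2)] in auto)
  then show ?thesis using True by (simp add: ncomp_def)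
next
  case False
  define X where "X = linked F `` {x}"
  define Y where "Y = linked F `` {y}"
  have part: "partition_on (\<Union>F) (components F)" by (rule partition_on_components)
  have finC: "finite (components F)" by (rule finite_elements[OF fin part])
  have XC: "X \<in> components F" "Y \<in> components F"
    using xy unfolding components_linked X_def Y_def by (metis quotientI)+
  have xX: "x \<in> X" "y \<in> Y" using xy by (simp_all add: X_def Y_def linked_refl)
  have "y \<notin> X" using False by (simp add: X_def)
  then have ne: "X \<noteq> Y" using xX by auto
  define P where "P = insert (X \<union> Y) (components F - {X, Y})"
  have pP: "partition_on (\<Union>F) P"
    unfolding partition_on_def
  proof (intro conjI)
    show "\<Union>P = \<Union>F" using partition_onD1[OF part] XC by (auto simp: P_def)
    show "{} \<notin> P" using partition_onD3[OF part] xX by (auto simp: P_def)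
    have *: "B \<inter> C = {}" if "B \<in> components F" "C \<in> components F" "B \<noteq> C" for B C
      using partition_onD2[OF part] that by (auto simp: disjoint_def)
    have "C \<inter> (X \<union> Y) = {}" if "C \<in> components F - {X, Y}" for C
      using *[of C X] *[of C Y] that XC by blast
    then show "disjoint P" using * by (auto simp: P_def disjoint_def)
  qed
  have "linked (insert {x, y} F) = linked P"
  proof
    show "linked (insert {x, y} F) \<subseteq> linked P"
    proof (rule linked_subset)
      fix B v w assume B: "B \<in> insert {x, y} F" "v \<in> B" "w \<in> B"
      have "\<exists>D\<in>P. B \<subseteq> D"
      proof (cases "B = {x, y}")
        case True
        then show ?thesis using xX by (auto simp: P_def)
      next
        case False
        then obtain C where "C \<in> components F" "B \<subseteq> C"
          using components_coarser[of B F] B by auto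
        then show ?thesis unfolding P_def by blast
      qed
      then show "(v, w) \<in> linked P" using B by (auto intro: linkedI)
    qed
    show "linked P \<subseteq> linked (insert {x, y} F)"
    proof (rule linked_subset)
      fix B v w assume B: "B \<in> P" "v \<in> B" "w \<in> B"
      let ?L = "linked (insert {x, y} F)"
      have sub: "linked F \<subseteq> ?L" by (rule linked_mono) auto
      show "(v, w) \<in> ?L"
      proof (cases "B \<in> components F")
        case True
        then show ?thesis using mem_components[OF True] B sub by blast
      next
        case False
        then have "B = X \<union> Y" using B by (auto simp: P_def)
        moreover have "(x, y) \<in> ?L" by (rule linkedI[of "{x, y}"]) auto
        ultimately have "(x, u) \<in> ?L" if "u \<in> B" for u
          using that sub linked_trans[of x y "insert {x, y} F" u] by (auto simp: X_def Y_def)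
        from linked_trans[OF linked_sym[OF this[OF B(2)]] this[OF B(3)]] show ?thesis .
      qed
    qed
  qed
  then have "ncomp (insert {x, y} F) = card P"
    using ncomp_cong_linked ncomp_partition[OF pP] by metis
  also have "\<dots> = Suc (card (components F - {X, Y}))"
  proof -
    have "X \<union> Y \<notin> components F - {X, Y}"
      using partition_block_unique[OF part, of "X \<union> Y" X x] XC xX by auto
    then show ?thesis using finC by (simp add: P_def)
  qed
  also have "card (components F - {X, Y}) = card (components F) - 2"
    using XC ne finC by (simp add: card_Diff_subset)
  finally show ?thesis
    using False card_mono[OF finC, of "{X, Y}"] XC ne by (simp add: ncomp_def)
qed

text \<open>
  Adding \<open>G\<close> to \<open>F \<union> H\<close> merges at most as many components as adding \<open>G\<close> to \<open>F\<close>.  For one edge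
  this says that its ends stay connected when the family grows, and the family \<open>G\<close> connects the
  same points as the edges \<open>{x, y}\<close> inside its members.
\<close>

lemma ncomp_submodular:
  assumes fin: "finite (\<Union>F)" and GH: "\<Union>G \<subseteq> \<Union>F" "\<Union>H \<subseteq> \<Union>F"
  shows "ncomp (F \<union> G) + ncomp (F \<union> H) \<le> ncomp F + ncomp (F \<union> G \<union> H)"
proof -
  \<comment> \<open>With \<open>x = y\<close> allowed, singleton members of \<open>G\<close> also give an edge.\<close>
  define E where "E = {{x, y} | x y. \<exists>B\<in>G. x \<in> B \<and> y \<in> B}"
  have EF: "\<Union>E \<subseteq> \<Union>F" using GH by (auto simp: E_def)
  have finE: "finite E" by (rule finite_subset[of _ "Pow (\<Union>F)"]) (use EF fin in auto)
  have lE: "linked E = linked G"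
  proof
    show "linked E \<subseteq> linked G" by (rule linked_subset) (auto simp: E_def intro: linkedI)
    show "linked G \<subseteq> linked E"
    proof (rule linked_subset)
      fix B x y assume "B \<in> G" "x \<in> B" "y \<in> B"
      then have "{x, y} \<in> E" by (auto simp: E_def)
      then show "(x, y) \<in> linked E" by (rule linkedI) auto
    qed
  qed
  have "ncomp (F \<union> E') + ncomp (F \<union> H) \<le> ncomp F + ncomp (F \<union> H \<union> E')" if "E' \<subseteq> E" for E'
    using finite_subset[OF that finE] that
  proof (induction E' rule: finite_induct)
    case (insert e E')
    then obtain x y where e: "e = {x, y}" by (auto simp: E_def)
    have xy: "x \<in> \<Union>F" "y \<in> \<Union>F" using e insert.prems EF by auto
    have U: "\<Union>(F \<union> E') = \<Union>F" "\<Union>(F \<union> H \<union> E') = \<Union>F"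
      using Union_mono[of E' E] insert.prems EF GH by auto
    have "ncomp (F \<union> E') = ncomp (insert e (F \<union> E')) + (if (x, y) \<in> linked (F \<union> E') then 0 else 1)"
      unfolding e by (rule ncomp_insert_edge) (use U xy fin in auto)
    moreover have "ncomp (F \<union> H \<union> E') = ncomp (insert e (F \<union> H \<union> E'))
        + (if (x, y) \<in> linked (F \<union> H \<union> E') then 0 else 1)"
      unfolding e by (rule ncomp_insert_edge) (use U xy fin in auto)
    moreover have "linked (F \<union> E') \<subseteq> linked (F \<union> H \<union> E')" by (rule linked_mono) auto
    ultimately show ?case using insert.IH insert.prems by (auto split: if_splits)
  qed simp
  from this[of E] have "ncomp (E \<union> F) + ncomp (F \<union> H) \<le> ncomp F + ncomp (E \<union> (F \<union> H))"
    by (simp add: Un_ac)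
  moreover have "ncomp (E \<union> K) = ncomp (G \<union> K)" for K
    by (rule ncomp_cong_linked, rule linked_Un_cong, rule lE)
  ultimately show ?thesis by (simp add: Un_ac)
qed

lemma ncomp_antimono:
  assumes fin: "finite (\<Union>F)" and G: "\<Union>G \<subseteq> \<Union>F"
  shows "ncomp (F \<union> G) \<le> ncomp F"
proof -
  have U: "\<Union>(F \<union> G) = \<Union>F" using G by auto
  show ?thesis unfolding ncomp_def
  proof (rule coarser_card(1)[OF partition_on_components _ fin])
    show "partition_on (\<Union>F) (components (F \<union> G))" using partition_on_components[of "F \<union> G"] U by simp
    show "\<forall>B\<in>components F. \<exists>C\<in>components (F \<union> G). B \<subseteq> C"
    proof
      fix B assume B: "B \<in> components F"
      then obtain x where x: "x \<in> B" using partition_onD3[OF partition_on_components] by (metis ex_in_conv)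
      have xF: "x \<in> \<Union>(F \<union> G)" using partition_onD1[OF partition_on_components, of F] B x by auto
      have "B \<subseteq> linked (F \<union> G) `` {x}"
        using mem_components[OF B x] linked_mono[of F "F \<union> G"] by auto
      moreover have "linked (F \<union> G) `` {x} \<in> components (F \<union> G)"
        unfolding components_linked by (rule quotientI[OF xF])
      ultimately show "\<exists>C\<in>components (F \<union> G). B \<subseteq> C" by blast
    qed
  qed
qed

text \<open>
  For partitions of the same set this is the triangle inequality of \<^const>\<open>pdist\<close>.
\<close>

lemma ncomp_triangle:
  assumes "finite V" "\<Union>F = V" "\<Union>G = V" "\<Union>H = V"
  shows "ncomp (F \<union> G) + ncomp (F \<union> H) \<le> ncomp F + ncomp (G \<union> H)"
proof -
  have "ncomp (F \<union> G) + ncomp (F \<union> H) \<le> ncomp F + ncomp (F \<union> G \<union> H)"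
    by (rule ncomp_submodular) (use assms in auto)
  also have "ncomp (F \<union> G \<union> H) \<le> ncomp (G \<union> H)"
    using ncomp_antimono[of "G \<union> H" F] assms by (simp add: Un_ac)
  finally show ?thesis by simp
qed

section \<open>Partition diagrams and their order\<close>

lemma partition_on_Un:
  assumes "partition_on A p" "partition_on B q" "A \<inter> B = {}"
  shows "partition_on (A \<union> B) (p \<union> q)"
  using assms disjoint_union[of p q] unfolding partition_on_def by simp

lemma image_Pair: "(\<lambda>i. (r, i)) ` A = {r} \<times> A"
  by auto

lemma image_two_rows:
  "f ` ({r, s} \<times> A) = (\<lambda>i. f (r, i)) ` A \<union> (\<lambda>i. f (s, i)) ` A"
proof -
  have "{r, s} \<times> A = Pair r ` A \<union> Pair s ` A" by auto
  then show ?thesis by (simp add: image_Un image_image)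
qed

lemma relabel_relabel: "relabel f (relabel g p) = relabel (f \<circ> g) p"
  by (simp add: relabel_def image_image image_comp)

lemma relabel_Un: "relabel f (p \<union> q) = relabel f p \<union> relabel f q"
  by (simp add: relabel_def image_Un)

lemma relabel_cong: "(\<And>x. x \<in> \<Union>p \<Longrightarrow> f x = g x) \<Longrightarrow> relabel f p = relabel g p"
  unfolding relabel_def by (intro image_cong refl) auto

lemma relabel_id: "(\<And>x. x \<in> \<Union>p \<Longrightarrow> f x = x) \<Longrightarrow> relabel f p = p"
  using relabel_cong[of p f id] by (simp add: relabel_def)

lemma Union_relabel: "\<Union>(relabel f p) = f ` \<Union>p"
  by (auto simp: relabel_def)

lemma Part_Union: "p \<in> Part k \<Longrightarrow> \<Union>p = {Top, Bottom} \<times> {..<k}"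
  by (simp add: Part_def partition_on_def)

lemma Part_vertex: "p \<in> Part k \<Longrightarrow> B \<in> p \<Longrightarrow> (r, i) \<in> B \<Longrightarrow> (r = Top \<or> r = Bottom) \<and> i < k"
  using Part_Union[of p k] by auto

lemma partition_relabel:
  assumes "partition_on V p" "inj_on f V"
  shows "partition_on (f ` V) (relabel f p)"
proof -
  have "(`) f ` p - {{}} = (`) f ` p" using partition_onD3[OF assms(1)] by auto
  then show ?thesis using partition_on_inj_image[OF assms] by (simp add: relabel_def)
qed

lemma relabel_Part:
  assumes "p \<in> Part k" "inj_on f ({Top, Bottom} \<times> {..<k})"
    "f ` ({Top, Bottom} \<times> {..<k}) = {Top, Bottom} \<times> {..<n}"
  shows "relabel f p \<in> Part n"
proof -
  have "partition_on ({Top, Bottom} \<times> {..<k}) p" using assms(1) unfolding Part_def by (rule CollectD)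
  from partition_relabel[OF this assms(2)] show ?thesis
    unfolding Part_def assms(3) by (rule CollectI)
qed

lemma id_diagram_Part: "id_diagram k \<in> Part k"
  unfolding Part_def partition_on_def disjoint_def id_diagram_def by auto

lemma nc_ncomp: "p \<in> Part k \<Longrightarrow> nc p = ncomp p"
  unfolding Part_def nc_def using ncomp_partition by force

lemma nc_pjoin: "nc (p \<squnion>\<^sub>P q) = ncomp (p \<union> q)"
  by (simp add: nc_def ncomp_def pjoin_def)

lemma components_absorb_points:
  assumes "\<And>B. B \<in> G \<Longrightarrow> \<exists>x\<in>\<Union>F. B \<subseteq> {x}"
  shows "components (F \<union> G) = components F"
proof (rule components_absorb)
  fix B x y assume B: "B \<in> G" "x \<in> B" "y \<in> B"
  from assms[OF B(1)] obtain z where "z \<in> \<Union>F" "B \<subseteq> {z}" by blast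
  then show "(x, y) \<in> linked F" using B linked_refl[of z F] by auto
qed

lemma ncomp_absorb_points:
  "(\<And>B. B \<in> G \<Longrightarrow> \<exists>x\<in>\<Union>F. B \<subseteq> {x}) \<Longrightarrow> ncomp (F \<union> G) = ncomp F"
  unfolding ncomp_def by (subst components_absorb_points) auto

text \<open>
  The number of cycles of a diagram, computed by identifying \<open>i\<close> with \<open>i'\<close>, that is, by forgetting the
  row of each vertex.
\<close>

definition ncyc :: "diagram \<Rightarrow> nat" where
  "ncyc p = ncomp ((`) snd ` p)"

lemma ncomp_id_diagram:
  assumes U: "\<Union>p = {Top, Bottom} \<times> {..<k}"
  shows "ncomp (p \<union> id_diagram k) = ncyc p"
proof -
  let ?F = "p \<union> id_diagram k"
  have UF: "\<Union>?F = {Top, Bottom} \<times> {..<k}" using U Part_Union[OF id_diagram_Part] by auto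
  have "ncomp ?F = ncomp ((`) snd ` ?F)"
  proof (rule ncomp_contract[symmetric])
    fix x y assume xy: "x \<in> \<Union>?F" "y \<in> \<Union>?F" "snd x = snd y"
    show "(x, y) \<in> linked ?F"
      by (rule linkedI[of "{(Top, snd x), (Bottom, snd x)}"])
        (use xy in \<open>unfold UF, auto simp: id_diagram_def\<close>)
  qed
  also have "(`) snd ` ?F = (`) snd ` p \<union> (`) snd ` id_diagram k" by (rule image_Un)
  also have "ncomp \<dots> = ncomp ((`) snd ` p)"
  proof (rule ncomp_absorb_points)
    fix B assume "B \<in> (`) snd ` id_diagram k"
    then obtain i where i: "i < k" "B = {i}" by (auto simp: id_diagram_def)
    then have "(Top, i) \<in> \<Union>p" using U by simp
    then have "i \<in> \<Union>((`) snd ` p)" by force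
    then show "\<exists>x\<in>\<Union>((`) snd ` p). B \<subseteq> {x}" using i by blast
  qed
  finally show ?thesis by (simp add: ncyc_def)
qed

text \<open>
  In the equality of distances that defines the order, the two halved block numbers of \<open>p\<close> add up
  and those of \<open>q\<close> and of the identity cancel; what is left is an equality of natural numbers.
\<close>

lemma pleq_iff:
  assumes "p \<in> Part k" "q \<in> Part k"
  shows "pleq k p q \<longleftrightarrow> ncomp p + ncyc q = ncyc p + ncomp (p \<union> q)"
proof -
  have "nc (id_diagram k \<squnion>\<^sub>P p) = ncyc p" "nc (id_diagram k \<squnion>\<^sub>P q) = ncyc q"
    using ncomp_id_diagram[OF Part_Union] assms by (simp_all add: nc_pjoin Un_commute)
  then have "pleq k p q \<longleftrightarrow> real (ncomp p) + real (ncyc q) = real (ncyc p) + real (ncomp (p \<union> q))"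
    using assms by (auto simp: pleq_def pdist_def nc_pjoin nc_ncomp field_simps)
  also have "\<dots> \<longleftrightarrow> ncomp p + ncyc q = ncyc p + ncomp (p \<union> q)"
    by (simp only: of_nat_add[symmetric] of_nat_eq_iff)
  finally show ?thesis .
qed

lemma ncyc_triangle:
  assumes "p \<in> Part k" "q \<in> Part k"
  shows "ncyc p + ncomp (p \<union> q) \<le> ncomp p + ncyc q"
proof -
  have "ncomp (p \<union> id_diagram k) + ncomp (p \<union> q) \<le> ncomp p + ncomp (id_diagram k \<union> q)"
    by (rule ncomp_triangle[of "{Top, Bottom} \<times> {..<k}"])
      (use assms Part_Union id_diagram_Part in auto)
  then show ?thesis
    using ncomp_id_diagram[OF Part_Union] assms by (simp add: Un_commute)
qed

section \<open>Composition and the order in twice as many columns\<close>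

definition upper :: "vertex \<Rightarrow> vertex" where
  "upper = (\<lambda>(r, i). (if r = Bottom then Middle else r, i))"

definition lower :: "vertex \<Rightarrow> vertex" where
  "lower = (\<lambda>(r, i). (if r = Top then Middle else r, i))"

lemma upper_simps [simp]:
  "upper (Top, i) = (Top, i)" "upper (Middle, i) = (Middle, i)" "upper (Bottom, i) = (Middle, i)"
  by (simp_all add: upper_def)

lemma lower_simps [simp]:
  "lower (Top, i) = (Middle, i)" "lower (Middle, i) = (Middle, i)" "lower (Bottom, i) = (Bottom, i)"
  by (simp_all add: lower_def)

text \<open>
  The three-row diagram of the composition \<open>p \<circ> q\<close> before the middle row is erased.
\<close>

definition stack :: "diagram \<Rightarrow> diagram \<Rightarrow> diagram" where
  "stack p q = relabel upper q \<union> relabel lower p"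

text \<open>
  Counts the components inside the middle row, which a composition forgets.
\<close>

definition hidden :: "diagram \<Rightarrow> diagram \<Rightarrow> nat" where
  "hidden p q = card {C \<in> components (stack p q). C \<inter> {Top, Bottom} \<times> UNIV = {}}"

lemma pcomp_stack:
  "p \<circ>\<^sub>P q = (\<lambda>B. B \<inter> {Top, Bottom} \<times> UNIV) ` components (stack p q) - {{}}"
  by (simp add: pcomp_def stack_def restrict_diagram_def upper_def lower_def)

lemma Union_stack:
  assumes "p \<in> Part k" "q \<in> Part k"
  shows "\<Union>(stack p q) = {Top, Middle, Bottom} \<times> {..<k}"
  unfolding stack_def Union_Un_distrib Union_relabel Part_Union[OF assms(1)] Part_Union[OF assms(2)]
    image_two_rows upper_simps lower_simps image_Pair
  by blast

lemma pcomp_Part: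
  assumes "p \<in> Part k" "q \<in> Part k"
  shows "p \<circ>\<^sub>P q \<in> Part k"
proof -
  have "partition_on ({Top, Bottom} \<times> UNIV \<inter> \<Union>(stack p q)) (p \<circ>\<^sub>P q)"
    using partition_on_restrict[OF partition_on_components, of "{Top, Bottom} \<times> UNIV" "stack p q"]
    by (simp add: pcomp_stack Int_commute)
  moreover have "{Top, Bottom} \<times> UNIV \<inter> \<Union>(stack p q) = {Top, Bottom} \<times> {..<k}"
    unfolding Union_stack[OF assms] by auto
  ultimately show ?thesis by (simp add: Part_def)
qed

lemma ncomp_stack:
  assumes pq: "p \<in> Part k" "q \<in> Part k" and G: "\<Union>G \<subseteq> {Top, Bottom} \<times> {..<k}"
  shows "ncomp (stack p q \<union> G) = ncomp (p \<circ>\<^sub>P q \<union> G) + hidden p q"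
  unfolding pcomp_stack hidden_def
proof (rule ncomp_erase)
  show "finite (\<Union>(stack p q))" by (simp add: Union_stack[OF pq])
  show "\<Union>G \<subseteq> {Top, Bottom} \<times> UNIV \<inter> \<Union>(stack p q)"
    unfolding Union_stack[OF pq] by (rule subset_trans[OF G]) auto
qed

text \<open>
  Three diagrams on three rows: \<open>p2\<close> from top to middle, \<open>p1\<close> from middle to bottom, \<open>p\<close> from top to
  bottom.
\<close>

definition join3 :: "diagram \<Rightarrow> diagram \<Rightarrow> diagram \<Rightarrow> nat" where
  "join3 p1 p2 p = ncomp (stack p1 p2 \<union> p)"

text \<open>
  The diagram \<open>(p \<otimes> id) \<circ> \<tau>\<close> of the Kreweras complement, with the composition carried out.
\<close>

definition twist :: "nat \<Rightarrow> diagram \<Rightarrow> diagram" where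
  "twist k p = relabel (\<lambda>(r, i). (r, if r = Top then k + i else i)) p \<union>
    {{(Top, i), (Bottom, k + i)} | i. i < k}"

lemma twist_Part:
  assumes p: "p \<in> Part k"
  shows "twist k p \<in> Part (2 * k)"
proof -
  let ?f = "\<lambda>(r :: row, i :: nat). (r, if r = Top then k + i else i)"
  let ?E = "{{(Top, i), (Bottom, k + i)} | i. i < k} :: diagram"
  have 1: "partition_on (?f ` ({Top, Bottom} \<times> {..<k})) (relabel ?f p)"
    by (rule partition_relabel[OF p[unfolded Part_def, simplified]])
      (auto simp: inj_on_def split: if_splits)
  have 2: "partition_on ({Top} \<times> {..<k} \<union> {Bottom} \<times> {k..<2 * k}) ?E"
  proof -
    have "(r, j) \<in> \<Union>?E" if "r = Bottom" "k \<le> j" "j < 2 * k" for r j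
    proof -
      have "{(Top, j - k), (Bottom, j)} \<in> ?E" using that by force
      then show ?thesis using that by blast
    qed
    then show ?thesis unfolding partition_on_def disjoint_def by auto
  qed
  have "(\<lambda>i. (Top, k + i)) ` {..<k} = {Top} \<times> {k..<2 * k}"
  proof -
    have "(\<lambda>i. (Top, k + i)) ` {..<k} = (\<lambda>i. (Top, i)) ` (+) k ` {0..<k}"
      unfolding image_image lessThan_atLeast0 by (rule refl)
    also have "(+) k ` {0..<k} = {k..<2 * k}" by (simp add: mult_2)
    finally show ?thesis by (simp only: image_Pair)
  qed
  then have 3: "?f ` ({Top, Bottom} \<times> {..<k}) = {Top} \<times> {k..<2 * k} \<union> {Bottom} \<times> {..<k}"
    unfolding image_two_rows by (simp add: image_Pair)
  have "partition_on (({Top} \<times> {k..<2 * k} \<union> {Bottom} \<times> {..<k}) \<union>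
      ({Top} \<times> {..<k} \<union> {Bottom} \<times> {k..<2 * k})) (twist k p)"
    unfolding twist_def by (rule partition_on_Un[OF 1[unfolded 3] 2]) auto
  moreover have "({Top} \<times> {k..<2 * k} \<union> {Bottom} \<times> {..<k}) \<union>
      ({Top} \<times> {..<k} \<union> {Bottom} \<times> {k..<2 * k}) = {Top, Bottom} \<times> {..<2 * k}" by auto
  ultimately show ?thesis by (simp add: Part_def)
qed

definition shift :: "nat \<Rightarrow> vertex \<Rightarrow> vertex" where
  "shift k = (\<lambda>(r, i). (r, k + i))"

lemma shift_simp [simp]: "shift k (r, i) = (r, k + i)"
  by (simp add: shift_def)

lemma ptensor_shift: "ptensor k p q = p \<union> relabel (shift k) q"
  by (simp add: ptensor_def shift_def)

lemma Union_relabel_shift: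
  assumes "q \<in> Part l"
  shows "\<Union>(relabel (shift k) q) = {Top, Bottom} \<times> {k..<k + l}"
proof -
  have "(r, j) \<in> shift k ` ({Top, Bottom} \<times> {..<l})" if "r \<in> {Top, Bottom}" "k \<le> j" "j < k + l" for r j
    by (rule image_eqI[of _ _ "(r, j - k)"]) (use that in auto)
  then show ?thesis unfolding Union_relabel Part_Union[OF assms] by auto
qed

lemma inj_shift: "inj_on (shift k) A"
  by (auto simp: inj_on_def shift_def)

lemma ptensor_Part:
  assumes p: "p \<in> Part k" and q: "q \<in> Part l"
  shows "ptensor k p q \<in> Part (k + l)"
proof -
  have "partition_on (shift k ` ({Top, Bottom} \<times> {..<l})) (relabel (shift k) q)"
    by (rule partition_relabel[OF _ inj_shift]) (use q in \<open>simp add: Part_def\<close>)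
  then have "partition_on ({Top, Bottom} \<times> {k..<k + l}) (relabel (shift k) q)"
    using Union_relabel_shift[OF q, of k] unfolding Union_relabel Part_Union[OF q] by simp
  then have "partition_on ({Top, Bottom} \<times> {..<k} \<union> {Top, Bottom} \<times> {k..<k + l}) (ptensor k p q)"
    unfolding ptensor_shift
    by (rule partition_on_Un[OF p[unfolded Part_def, THEN CollectD]]) auto
  moreover have "{Top, Bottom} \<times> {..<k} \<union> {Top, Bottom} \<times> {k..<k + l} = {Top, Bottom} \<times> {..<k + l}"
    by auto
  ultimately show ?thesis by (simp add: Part_def)
qed

lemma ncomp_ptensor:
  assumes p: "p \<in> Part k" and q: "q \<in> Part l"
  shows "ncomp (ptensor k p q) = ncomp p + ncomp q"
proof -
  have "ncomp (ptensor k p q) = ncomp p + ncomp (relabel (shift k) q)"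
    unfolding ptensor_shift
    by (rule ncomp_disjoint) (auto simp: Union_relabel_shift[OF q] Part_Union[OF p])
  also have "ncomp (relabel (shift k) q) = ncomp q"
    unfolding relabel_def by (rule ncomp_inj[OF inj_shift])
  finally show ?thesis .
qed

lemma ncyc_ptensor:
  assumes p: "p \<in> Part k" and q: "q \<in> Part l"
  shows "ncyc (ptensor k p q) = ncyc p + ncyc q"
proof -
  have U: "\<Union>((`) snd ` p') = snd ` \<Union>p'" for p' :: diagram by auto
  have "ncyc (ptensor k p q) = ncomp ((`) snd ` p \<union> (`) snd ` relabel (shift k) q)"
    by (simp add: ncyc_def ptensor_shift image_Un)
  also have "\<dots> = ncyc p + ncomp ((`) snd ` relabel (shift k) q)"
    unfolding ncyc_def
    by (rule ncomp_disjoint) (auto simp: U Union_relabel_shift[OF q] Part_Union[OF p])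
  also have "(`) snd ` relabel (shift k) q = (`) ((+) k) ` (`) snd ` q"
    unfolding relabel_def image_image by (intro image_cong refl) (auto simp: shift_def)
  also have "ncomp \<dots> = ncyc q"
    unfolding ncyc_def by (rule ncomp_inj) auto
  finally show ?thesis .
qed

lemma ncyc_twist:
  assumes p: "p \<in> Part k"
  shows "ncyc (twist k p) = ncyc p"
proof -
  \<comment> \<open>The edges of the twist join the columns \<open>i\<close> and \<open>k + i\<close>, which can therefore be identified.\<close>
  let ?h = "\<lambda>i. if i < k then i else i - k"
  let ?E = "{{(Top, i), (Bottom, k + i)} | i. i < k} :: diagram"
  let ?f = "\<lambda>(r :: row, i :: nat). (r, if r = Top then k + i else i)"
  let ?F = "(`) snd ` twist k p"
  have "ncomp ((`) ?h ` ?F) = ncomp ?F"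
  proof (rule ncomp_contract)
    have U: "\<Union>?F = {..<2 * k}"
    proof -
      have "\<Union>?F = snd ` \<Union>(twist k p)" by auto
      then show ?thesis by (simp add: Part_Union[OF twist_Part[OF p]] image_two_rows)
    qed
    have E: "(i, k + i) \<in> linked ?F" if "i < k" for i
    proof (rule linkedI[of "snd ` {(Top, i), (Bottom, k + i)}"])
      show "snd ` {(Top, i), (Bottom, k + i)} \<in> ?F"
        unfolding twist_def using that by (intro imageI UnI2) auto
    qed auto
    have h: "(?h i, i) \<in> linked ?F" if "i \<in> \<Union>?F" for i
      using E[of "i - k"] linked_refl[OF that] that unfolding U by auto
    fix x y assume "x \<in> \<Union>?F" "y \<in> \<Union>?F" "?h x = ?h y"
    then show "(x, y) \<in> linked ?F"
      using linked_trans[OF linked_sym[OF h[of x]] h[of y, folded \<open>?h x = ?h y\<close>]] by simp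
  qed
  moreover have "(`) ?h ` ?F = (`) snd ` p \<union> (`) ?h ` (`) snd ` ?E"
  proof -
    have "(`) ?h ` (`) snd ` relabel ?f p = (`) snd ` p"
      unfolding relabel_def image_image
    proof (rule image_cong[OF refl])
      fix B assume B: "B \<in> p"
      show "(\<lambda>x. ?h (snd (?f x))) ` B = snd ` B"
        by (rule image_cong[OF refl]) (use Part_vertex[OF p B] in auto)
    qed
    then show ?thesis unfolding twist_def image_Un by simp
  qed
  moreover have "ncomp ((`) snd ` p \<union> (`) ?h ` (`) snd ` ?E) = ncomp ((`) snd ` p)"
  proof (rule ncomp_absorb_points)
    fix B assume "B \<in> (`) ?h ` (`) snd ` ?E"
    then obtain i where i: "i < k" "B = {i}" by auto
    then have "(Top, i) \<in> \<Union>p" using Part_Union[OF p] by simp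
    then have "i \<in> \<Union>((`) snd ` p)" by force
    then show "\<exists>x\<in>\<Union>((`) snd ` p). B \<subseteq> {x}" using i by blast
  qed
  ultimately show ?thesis by (simp add: ncyc_def)
qed

text \<open>
  The edges \<open>{i, (k + i)'}\<close> of the twisted diagram glue the top row of \<open>p1\<close> to the bottom row of
  \<open>p2\<close>.  Contracting them turns the \<open>2k\<close> columns into three rows of \<open>k\<close> vertices, in which \<open>p\<close> joins
  the top row of \<open>p2\<close> to the bottom row of \<open>p1\<close>.
\<close>

lemma ncomp_ptensor_twist:
  assumes p1: "p1 \<in> Part k" and p2: "p2 \<in> Part k" and p: "p \<in> Part k"
  shows "ncomp (ptensor k p1 p2 \<union> twist k p) = join3 p1 p2 p"
proof -
  define h :: "vertex \<Rightarrow> vertex" where "h = (\<lambda>(r, i).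
    if r = Top then (if i < k then (Middle, i) else (Top, i - k))
    else (if i < k then (Bottom, i) else (Middle, i - k)))"
  let ?E = "{{(Top, i), (Bottom, k + i)} | i. i < k} :: diagram"
  let ?f = "\<lambda>(r :: row, i :: nat). (r, if r = Top then k + i else i)"
  let ?F = "ptensor k p1 p2 \<union> twist k p"
  have U: "\<Union>?F = {Top, Bottom} \<times> {..<2 * k}"
    unfolding Union_Un_distrib Part_Union[OF twist_Part[OF p]] Part_Union[OF ptensor_Part[OF p1 p2]]
    by (simp add: mult_2)
  have "ncomp ((`) h ` ?F) = ncomp ?F"
  proof (rule ncomp_contract)
    have E: "((Top, i), (Bottom, k + i)) \<in> linked ?F" if "i < k" for i
    proof (rule linkedI[of "{(Top, i), (Bottom, k + i)}"])
      show "{(Top, i), (Bottom, k + i)} \<in> ?F" unfolding twist_def using that by blast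
    qed auto
    fix x y assume xy: "x \<in> \<Union>?F" "y \<in> \<Union>?F" "h x = h y"
    obtain r i where x: "x = (r, i)" by (cases x)
    obtain s j where y: "y = (s, j)" by (cases y)
    have ri: "r = Top \<or> r = Bottom" "i < 2 * k" "s = Top \<or> s = Bottom" "j < 2 * k"
      using xy(1,2) unfolding U x y by auto
    have "(x, y) \<in> linked ?F" if "x = y" using that xy(1) by (simp add: linked_refl)
    moreover have "x = y \<or> (\<exists>i<k. (x = (Top, i) \<and> y = (Bottom, k + i)) \<or> (y = (Top, i) \<and> x = (Bottom, k + i)))"
    proof (cases "r = s")
      case True
      then show ?thesis using ri xy(3) unfolding x y h_def by (auto split: if_splits)
    next
      case False
      then have "(r = Top \<and> s = Bottom) \<or> (r = Bottom \<and> s = Top)" using ri by auto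
      then show ?thesis
      proof
        assume rs: "r = Top \<and> s = Bottom"
        then have "i < k" "j = k + i" using xy(3) unfolding x y h_def by (auto split: if_splits)
        then show ?thesis using rs x y by auto
      next
        assume rs: "r = Bottom \<and> s = Top"
        then have "j < k" "i = k + j" using xy(3) unfolding x y h_def by (auto split: if_splits)
        then show ?thesis using rs x y by auto
      qed
    qed
    ultimately show "(x, y) \<in> linked ?F" using E E[THEN linked_sym] by auto
  qed
  moreover have "(`) h ` ?F = (stack p1 p2 \<union> p) \<union> relabel h ?E"
  proof -
    have "relabel h p1 = relabel lower p1"
      by (rule relabel_cong) (auto simp: Part_Union[OF p1] h_def)
    moreover have "relabel h (relabel (shift k) p2) = relabel upper p2"
      unfolding relabel_relabel
      by (rule relabel_cong) (auto simp: Part_Union[OF p2] h_def)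
    moreover have "relabel h (relabel ?f p) = p"
      unfolding relabel_relabel
      by (rule relabel_id) (auto simp: Part_Union[OF p] h_def)
    ultimately have "relabel h ?F = (stack p1 p2 \<union> p) \<union> relabel h ?E"
      unfolding ptensor_shift twist_def relabel_Un stack_def by auto
    then show ?thesis by (simp add: relabel_def)
  qed
  moreover have "ncomp ((stack p1 p2 \<union> p) \<union> relabel h ?E) = ncomp (stack p1 p2 \<union> p)"
  proof (rule ncomp_absorb_points)
    fix B assume "B \<in> relabel h ?E"
    then obtain i where i: "i < k" "B = {(Middle, i)}" by (auto simp: relabel_def h_def)
    then have "(Middle, i) \<in> \<Union>(stack p1 p2 \<union> p)" using Union_stack[OF p1 p2] by auto
    then show "\<exists>x\<in>\<Union>(stack p1 p2 \<union> p). B \<subseteq> {x}" using i by blast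
  qed
  ultimately show ?thesis by (simp add: join3_def)
qed

text \<open>
  Everything in the condition \<open>p1 \<otimes> p2 \<le> twist k p\<close> is thereby expressed by the three diagrams on \<open>k\<close>
  columns.  The inequality says that the condition is the equality case of a general bound, which
  lets it be split into two such equality cases.
\<close>

lemma pleq_twist_iff:
  assumes p1: "p1 \<in> Part k" and p2: "p2 \<in> Part k" and p: "p \<in> Part k"
  shows "pleq (2 * k) (ptensor k p1 p2) (twist k p) \<longleftrightarrow>
      ncomp p1 + ncomp p2 + ncyc p = ncyc p1 + ncyc p2 + join3 p1 p2 p"
    and "ncyc p1 + ncyc p2 + join3 p1 p2 p \<le> ncomp p1 + ncomp p2 + ncyc p"
proof -
  have t: "ptensor k p1 p2 \<in> Part (2 * k)" using ptensor_Part[OF p1 p2] by (simp add: mult_2)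
  show "pleq (2 * k) (ptensor k p1 p2) (twist k p) \<longleftrightarrow>
      ncomp p1 + ncomp p2 + ncyc p = ncyc p1 + ncyc p2 + join3 p1 p2 p"
    using pleq_iff[OF t twist_Part[OF p]] assms
    by (simp add: ncomp_ptensor ncyc_ptensor ncyc_twist ncomp_ptensor_twist)
  show "ncyc p1 + ncyc p2 + join3 p1 p2 p \<le> ncomp p1 + ncomp p2 + ncyc p"
    using ncyc_triangle[OF t twist_Part[OF p]] assms
    by (simp add: ncomp_ptensor ncyc_ptensor ncyc_twist ncomp_ptensor_twist)
qed

text \<open>
  Write \<open>s = p1 \<circ> p2\<close> and \<open>h\<close> for the number of components hidden by this composition.  Erasing the
  middle row gives \<open>join3 p1 p2 p = ncomp (s \<union> p) + h\<close> and \<open>join3 p1 p2 s = ncomp s + h\<close>.  Hence the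
  bound belonging to \<open>p1 \<otimes> p2 \<le> twist k p\<close> is the sum of the bounds belonging to \<open>s \<le> p\<close> and to
  \<open>p1 \<otimes> p2 \<le> twist k s\<close>, and a sum of two bounds is attained iff both are.
\<close>

lemma pleq_twist_pcomp:
  assumes p1: "p1 \<in> Part k" and p2: "p2 \<in> Part k" and p: "p \<in> Part k"
  shows "pleq (2 * k) (ptensor k p1 p2) (twist k p) \<longleftrightarrow>
    pleq k (p1 \<circ>\<^sub>P p2) p \<and> pleq (2 * k) (ptensor k p1 p2) (twist k (p1 \<circ>\<^sub>P p2))"
proof -
  define s where "s = p1 \<circ>\<^sub>P p2"
  have s: "s \<in> Part k" unfolding s_def by (rule pcomp_Part[OF p1 p2])
  have J: "join3 p1 p2 p = ncomp (s \<union> p) + hidden p1 p2"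
    unfolding join3_def s_def by (rule ncomp_stack[OF p1 p2]) (simp add: Part_Union[OF p])
  have Js: "join3 p1 p2 s = ncomp (s \<union> s) + hidden p1 p2"
    unfolding join3_def s_def[symmetric] using ncomp_stack[OF p1 p2, of s] Part_Union[OF s]
    by (simp add: s_def)
  show ?thesis
    unfolding s_def[symmetric] pleq_twist_iff(1)[OF p1 p2 p] pleq_twist_iff(1)[OF p1 p2 s] pleq_iff[OF s p]
    using pleq_twist_iff(2)[OF p1 p2 s] ncyc_triangle[OF s p] J Js by auto
qed

lemma flip_vertex_inv [simp]: "flip_vertex (flip_vertex x) = x"
  by (cases x rule: flip_vertex.cases) auto

lemma flip_Part: "p \<in> Part k \<Longrightarrow> flip p \<in> Part k"
  unfolding flip_def
proof (rule relabel_Part)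
  show "inj_on flip_vertex ({Top, Bottom} \<times> {..<k})" by (rule inj_on_inverseI[of _ flip_vertex]) simp
  show "flip_vertex ` ({Top, Bottom} \<times> {..<k}) = {Top, Bottom} \<times> {..<k}"
    unfolding image_two_rows by auto
qed

text \<open>
  The same argument with the row between \<open>p\<close> and \<open>p1\<close> erased.  Put \<open>r = flip p1 \<circ> p\<close> and let \<open>h\<close> count
  the components hidden in this composition.  Then \<open>join3 p1 p2 p = ncomp (p2 \<union> r) + h\<close>, and closing
  the two outer rows of the stack onto each other superposes \<open>p1\<close> and \<open>p\<close>, so that
  \<open>ncomp (p1 \<union> p) = ncyc r + h\<close>.  The bound for \<open>p1 \<otimes> p2 \<le> twist k p\<close> is again a sum of two.
\<close>

lemma pleq_twist_flip:
  assumes p1: "p1 \<in> Part k" and p2: "p2 \<in> Part k" and p: "p \<in> Part k"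
  shows "pleq (2 * k) (ptensor k p1 p2) (twist k p) \<longleftrightarrow> pleq k p1 p \<and> pleq k p2 (flip p1 \<circ>\<^sub>P p)"
proof -
  define r where "r = flip p1 \<circ>\<^sub>P p"
  have f1: "flip p1 \<in> Part k" by (rule flip_Part[OF p1])
  have r: "r \<in> Part k" unfolding r_def by (rule pcomp_Part[OF f1 p])
  define h where "h = hidden (flip p1) p"
  note vert = Part_Union[OF p1] Part_Union[OF p2] Part_Union[OF p]
  have J: "join3 p1 p2 p = ncomp (p2 \<union> r) + h"
  proof -
    \<comment> \<open>In the stack of \<open>r\<close> the erased row is the bottom row of \<open>join3\<close>, so the rows are renamed.\<close>
    let ?w = "\<lambda>(r :: row, i :: nat). (if r = Middle then Bottom else if r = Bottom then Middle else r, i)"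
    have "ncomp (relabel ?w (stack (flip p1) p \<union> p2)) = ncomp (stack (flip p1) p \<union> p2)"
      unfolding relabel_def by (rule ncomp_inj) (auto simp: inj_on_def split: if_splits)
    moreover have "relabel ?w (relabel upper p) = p"
      unfolding relabel_relabel by (rule relabel_id) (auto simp: vert)
    moreover have "relabel ?w (relabel lower (flip p1)) = relabel lower p1"
      unfolding relabel_relabel flip_def by (rule relabel_cong) (auto simp: vert)
    moreover have "relabel ?w p2 = relabel upper p2"
      by (rule relabel_cong) (auto simp: vert)
    ultimately have "ncomp (stack (flip p1) p \<union> p2) = join3 p1 p2 p"
      unfolding join3_def stack_def relabel_Un by (simp add: Un_ac)
    then show ?thesis
      using ncomp_stack[OF f1 p, of p2] vert unfolding r_def h_def by (simp add: Un_commute)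
  qed
  have C: "ncomp (p1 \<union> p) = ncyc r + h"
  proof -
    \<comment> \<open>The identity diagram glues the bottom row to the top row.\<close>
    let ?w = "\<lambda>(r :: row, i :: nat). (if r = Bottom then Top else r, i)"
    let ?F = "stack (flip p1) p \<union> id_diagram k"
    have "ncomp (relabel ?w ?F) = ncomp ?F"
      unfolding relabel_def
    proof (rule ncomp_contract)
      fix x y assume "x \<in> \<Union>?F" "y \<in> \<Union>?F" and w: "?w x = ?w y"
      then have "x \<in> {Top, Middle, Bottom} \<times> {..<k}" "y \<in> {Top, Middle, Bottom} \<times> {..<k}"
        using Union_stack[OF f1 p] Part_Union[OF id_diagram_Part, of k] by auto
      then have xy: "x = y \<or> (\<exists>i<k. x \<in> {(Top, i), (Bottom, i)} \<and> y \<in> {(Top, i), (Bottom, i)})"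
        using w by (auto split: if_splits)
      show "(x, y) \<in> linked ?F"
      proof (cases "x = y")
        case True
        then show ?thesis using \<open>x \<in> \<Union>?F\<close> by (simp add: linked_refl)
      next
        case False
        then obtain i where i: "i < k" "x \<in> {(Top, i), (Bottom, i)}" "y \<in> {(Top, i), (Bottom, i)}"
          using xy by auto
        then show ?thesis
          by (intro linkedI[of "{(Top, i), (Bottom, i)}"]) (auto simp: id_diagram_def)
      qed
    qed
    moreover have "relabel ?w (relabel upper p) = relabel upper p"
      by (rule relabel_id) (auto simp: Union_relabel vert)
    moreover have "relabel ?w (relabel lower (flip p1)) = relabel upper p1"
      unfolding relabel_relabel flip_def by (rule relabel_cong) (auto simp: vert)
    ultimately have "ncomp ?F = ncomp (relabel upper (p1 \<union> p) \<union> relabel ?w (id_diagram k))"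
      unfolding stack_def relabel_Un by (simp add: Un_ac)
    also have "\<dots> = ncomp (relabel upper (p1 \<union> p))"
    proof (rule ncomp_absorb_points)
      fix B assume "B \<in> relabel ?w (id_diagram k)"
      then obtain i where i: "i < k" "B = {(Top, i)}" by (auto simp: relabel_def id_diagram_def)
      then have "upper (Top, i) \<in> upper ` \<Union>(p1 \<union> p)"
        by (intro imageI) (simp add: vert)
      then have "(Top, i) \<in> \<Union>(relabel upper (p1 \<union> p))" by (simp only: Union_relabel upper_simps)
      then show "\<exists>x\<in>\<Union>(relabel upper (p1 \<union> p)). B \<subseteq> {x}" using i by blast
    qed
    also have "\<dots> = ncomp (p1 \<union> p)"
    proof -
      have "inj_on upper ({Top, Bottom} \<times> {..<k})" by (auto simp: inj_on_def)
      moreover have "\<Union>(p1 \<union> p) = {Top, Bottom} \<times> {..<k}" by (simp add: vert)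
      ultimately show ?thesis unfolding relabel_def by (intro ncomp_inj) simp
    qed
    finally have "ncomp (p1 \<union> p) = ncomp ?F" by simp
    also have "\<dots> = ncomp (r \<union> id_diagram k) + h"
      unfolding r_def h_def
      by (rule ncomp_stack[OF f1 p]) (simp add: Part_Union[OF id_diagram_Part])
    also have "ncomp (r \<union> id_diagram k) = ncyc r" by (rule ncomp_id_diagram[OF Part_Union[OF r]])
    finally show ?thesis .
  qed
  show ?thesis
    unfolding r_def[symmetric] pleq_twist_iff(1)[OF p1 p2 p] pleq_iff[OF p1 p] pleq_iff[OF p2 r]
    using ncyc_triangle[OF p1 p] ncyc_triangle[OF p2 r] J C by auto
qed

section \<open>Permuting columns\<close>

definition on_cols :: "(nat \<Rightarrow> nat) \<Rightarrow> vertex \<Rightarrow> vertex" where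
  "on_cols \<sigma> = (\<lambda>(r, i). (r, \<sigma> i))"

definition on_row :: "row \<Rightarrow> (nat \<Rightarrow> nat) \<Rightarrow> vertex \<Rightarrow> vertex" where
  "on_row s \<sigma> = (\<lambda>(r, i). (r, if r = s then \<sigma> i else i))"

lemma on_cols_simp [simp]: "on_cols \<sigma> (r, i) = (r, \<sigma> i)"
  by (simp add: on_cols_def)

lemma on_row_simp [simp]: "on_row s \<sigma> (r, i) = (r, if r = s then \<sigma> i else i)"
  by (simp add: on_row_def)

lemma relabel_cols_Part:
  assumes p: "p \<in> Part k" and \<sigma>: "\<sigma> permutes {..<k}"
  shows "relabel (on_cols \<sigma>) p \<in> Part k"
proof (rule relabel_Part[OF p])
  show "inj_on (on_cols \<sigma>) ({Top, Bottom} \<times> {..<k})"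
    by (rule inj_on_inverseI[of _ "on_cols (inv \<sigma>)"])
      (auto simp: on_cols_def permutes_inverses(2)[OF \<sigma>])
  have "(\<lambda>i. (r :: row, \<sigma> i)) ` {..<k} = {r} \<times> {..<k}" for r
  proof -
    have "(\<lambda>i. (r, \<sigma> i)) ` {..<k} = (\<lambda>i. (r, i)) ` \<sigma> ` {..<k}" unfolding image_image by (rule refl)
    then show ?thesis unfolding permutes_image[OF \<sigma>] image_Pair .
  qed
  then show "on_cols \<sigma> ` ({Top, Bottom} \<times> {..<k}) = {Top, Bottom} \<times> {..<k}"
    unfolding image_two_rows on_cols_simp by auto
qed

lemma relabel_row_Part:
  assumes p: "p \<in> Part k" and \<sigma>: "\<sigma> permutes {..<k}" and s: "s = Top \<or> s = Bottom"
  shows "relabel (on_row s \<sigma>) p \<in> Part k"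
proof (rule relabel_Part[OF p])
  show "inj_on (on_row s \<sigma>) ({Top, Bottom} \<times> {..<k})"
    by (rule inj_on_inverseI[of _ "on_row s (inv \<sigma>)"])
      (auto simp: on_row_def permutes_inverses(2)[OF \<sigma>])
  have "(\<lambda>i. (r :: row, \<sigma> i)) ` {..<k} = {r} \<times> {..<k}" for r
  proof -
    have "(\<lambda>i. (r, \<sigma> i)) ` {..<k} = (\<lambda>i. (r, i)) ` \<sigma> ` {..<k}" unfolding image_image by (rule refl)
    then show ?thesis unfolding permutes_image[OF \<sigma>] image_Pair .
  qed
  then show "on_row s \<sigma> ` ({Top, Bottom} \<times> {..<k}) = {Top, Bottom} \<times> {..<k}"
    unfolding image_two_rows on_row_simp using s by (elim disjE) (simp_all add: image_Pair, blast+)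
qed

lemma perm_diagram_row: "perm_diagram k \<sigma> = relabel (on_row Bottom \<sigma>) (id_diagram k)"
proof -
  have "id_diagram k = (\<lambda>i. {(Top, i), (Bottom, i)}) ` {..<k}"
    "perm_diagram k \<sigma> = (\<lambda>i. {(Top, i), (Bottom, \<sigma> i)}) ` {..<k}"
    by (auto simp: id_diagram_def perm_diagram_def)
  then show ?thesis by (simp add: relabel_def image_image)
qed

lemma perm_diagram_Part: "\<sigma> permutes {..<k} \<Longrightarrow> perm_diagram k \<sigma> \<in> Part k"
  unfolding perm_diagram_row by (rule relabel_row_Part[OF id_diagram_Part]) auto

text \<open>
  Composition when each middle vertex is tied to one outer vertex \<open>g\<close>: moving the middle vertices
  there turns the permutation into single points, collected in \<open>G\<close>, which change nothing.
\<close>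

lemma pcomp_retract:
  assumes g: "\<And>r i. r \<noteq> Middle \<Longrightarrow> g (r, i) = (r, i)" "\<And>i. fst (g (Middle, i)) \<noteq> Middle"
    and lk: "\<And>i. (Middle, i) \<in> \<Union>(stack p q) \<Longrightarrow> ((Middle, i), g (Middle, i)) \<in> linked (stack p q)"
    and rel: "relabel g (stack p q) = P \<union> G" and P: "P \<in> Part k"
    and G: "\<And>B. B \<in> G \<Longrightarrow> \<exists>x\<in>{Top, Bottom} \<times> {..<k}. B \<subseteq> {x}"
  shows "p \<circ>\<^sub>P q = P"
proof -
  have "p \<circ>\<^sub>P q = components ((`) g ` stack p q)"
    unfolding pcomp_stack
  proof (rule restrict_components_retract)
    fix x :: vertex
    obtain r i where x: "x = (r, i)" by (cases x)
    show "g x = x" if "x \<in> {Top, Bottom} \<times> UNIV" using that g(1) unfolding x by auto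
    show "g x \<in> {Top, Bottom} \<times> UNIV"
    proof (cases r)
      case Middle
      then have "fst (g x) \<noteq> Middle" using g(2)[of i] x by simp
      then have "fst (g x) = Top \<or> fst (g x) = Bottom" by (cases "fst (g x)") simp_all
      then show ?thesis by (cases "g x") auto
    qed (use g(1)[of r i] x in auto)
    show "(x, g x) \<in> linked (stack p q)" if "x \<in> \<Union>(stack p q)"
      using g(1)[of r i] lk[of i] linked_refl[OF that] that unfolding x by (cases "r = Middle") auto
  qed
  also have "\<dots> = components (P \<union> G)" using rel by (simp add: relabel_def)
  also have "\<dots> = components P"
    by (rule components_absorb_points) (use G Part_Union[OF P] in simp)
  also have "\<dots> = P" using P unfolding Part_def by (intro components_of_partition) (rule CollectD)
  finally show ?thesis .
qed

lemma pcomp_perm_right: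
  assumes p: "p \<in> Part k" and \<sigma>: "\<sigma> permutes {..<k}"
  shows "p \<circ>\<^sub>P perm_diagram k \<sigma> = relabel (on_row Top (inv \<sigma>)) p"
proof -
  define g :: "vertex \<Rightarrow> vertex" where "g = (\<lambda>(r, i). if r = Middle then (Top, inv \<sigma> i) else (r, i))"
  have pd: "perm_diagram k \<sigma> = (\<lambda>i. {(Top, i), (Bottom, \<sigma> i)}) ` {..<k}"
    by (auto simp: perm_diagram_def)
  show ?thesis
  proof (rule pcomp_retract[of g])
    show "relabel g (stack p (perm_diagram k \<sigma>)) =
        relabel (on_row Top (inv \<sigma>)) p \<union> relabel (g \<circ> upper) (perm_diagram k \<sigma>)"
    proof -
      have "relabel (g \<circ> lower) p = relabel (on_row Top (inv \<sigma>)) p"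
        by (rule relabel_cong) (auto simp: Part_Union[OF p] g_def)
      then show ?thesis unfolding stack_def relabel_Un relabel_relabel by auto
    qed
    show "relabel (on_row Top (inv \<sigma>)) p \<in> Part k"
      by (rule relabel_row_Part[OF p permutes_inv[OF \<sigma>]]) simp
    show "((Middle, i), g (Middle, i)) \<in> linked (stack p (perm_diagram k \<sigma>))"
      if "(Middle, i) \<in> \<Union>(stack p (perm_diagram k \<sigma>))" for i
    proof (rule linkedI[of "upper ` {(Top, inv \<sigma> i), (Bottom, i)}"])
      have "i < k" using that Union_stack[OF p perm_diagram_Part[OF \<sigma>]] by auto
      then have "inv \<sigma> i < k" using permutes_in_image[OF permutes_inv[OF \<sigma>], of i] by simp
      then have "{(Top, inv \<sigma> i), (Bottom, \<sigma> (inv \<sigma> i))} \<in> perm_diagram k \<sigma>" unfolding pd by blast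
      then show "upper ` {(Top, inv \<sigma> i), (Bottom, i)} \<in> stack p (perm_diagram k \<sigma>)"
        unfolding stack_def relabel_def permutes_inverses(1)[OF \<sigma>] by blast
    qed (simp_all add: g_def)
    show "\<exists>x\<in>{Top, Bottom} \<times> {..<k}. B \<subseteq> {x}" if "B \<in> relabel (g \<circ> upper) (perm_diagram k \<sigma>)" for B
    proof -
      have "\<exists>i<k. B = {(Top, i)}"
        using that permutes_inverses(2)[OF \<sigma>] unfolding pd relabel_def by (auto simp: g_def)
      then show ?thesis by auto
    qed
  qed (auto simp: g_def)
qed

lemma pcomp_perm_left:
  assumes p: "p \<in> Part k" and \<sigma>: "\<sigma> permutes {..<k}"
  shows "perm_diagram k \<sigma> \<circ>\<^sub>P p = relabel (on_row Bottom \<sigma>) p"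
proof -
  define g :: "vertex \<Rightarrow> vertex" where "g = (\<lambda>(r, i). if r = Middle then (Bottom, \<sigma> i) else (r, i))"
  have pd: "perm_diagram k \<sigma> = (\<lambda>i. {(Top, i), (Bottom, \<sigma> i)}) ` {..<k}"
    by (auto simp: perm_diagram_def)
  have lt: "\<sigma> i < k" if "i < k" for i using that permutes_in_image[OF \<sigma>, of i] by simp
  show ?thesis
  proof (rule pcomp_retract[of g])
    show "relabel g (stack (perm_diagram k \<sigma>) p) =
        relabel (on_row Bottom \<sigma>) p \<union> relabel (g \<circ> lower) (perm_diagram k \<sigma>)"
    proof -
      have "relabel (g \<circ> upper) p = relabel (on_row Bottom \<sigma>) p"
        by (rule relabel_cong) (auto simp: Part_Union[OF p] g_def)
      then show ?thesis unfolding stack_def relabel_Un relabel_relabel by auto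
    qed
    show "relabel (on_row Bottom \<sigma>) p \<in> Part k"
      by (rule relabel_row_Part[OF p \<sigma>]) simp
    show "((Middle, i), g (Middle, i)) \<in> linked (stack (perm_diagram k \<sigma>) p)"
      if "(Middle, i) \<in> \<Union>(stack (perm_diagram k \<sigma>) p)" for i
    proof (rule linkedI[of "lower ` {(Top, i), (Bottom, \<sigma> i)}"])
      have "i < k" using that Union_stack[OF perm_diagram_Part[OF \<sigma>] p] by auto
      then have "{(Top, i), (Bottom, \<sigma> i)} \<in> perm_diagram k \<sigma>" unfolding pd by blast
      then show "lower ` {(Top, i), (Bottom, \<sigma> i)} \<in> stack (perm_diagram k \<sigma>) p"
        unfolding stack_def relabel_def by blast
    qed (simp_all add: g_def)
    show "\<exists>x\<in>{Top, Bottom} \<times> {..<k}. B \<subseteq> {x}" if "B \<in> relabel (g \<circ> lower) (perm_diagram k \<sigma>)" for B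
    proof -
      have "\<exists>i<k. B = {(Bottom, \<sigma> i)}"
        using that unfolding pd relabel_def by (auto simp: g_def)
      then show ?thesis using lt by auto
    qed
  qed (auto simp: g_def)
qed

lemma pcomp_conjugate:
  assumes p: "p \<in> Part k" and \<sigma>: "\<sigma> permutes {..<k}"
  shows "perm_diagram k \<sigma> \<circ>\<^sub>P p \<circ>\<^sub>P perm_diagram k (inv \<sigma>) = relabel (on_cols \<sigma>) p"
proof -
  have "perm_diagram k \<sigma> \<circ>\<^sub>P p \<circ>\<^sub>P perm_diagram k (inv \<sigma>) =
      relabel (on_row Top \<sigma>) (relabel (on_row Bottom \<sigma>) p)"
    using pcomp_perm_left[OF p \<sigma>] pcomp_perm_right[OF relabel_row_Part[OF p \<sigma>, of Bottom] permutes_inv[OF \<sigma>]]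
    by (simp add: permutes_inv_inv[OF \<sigma>])
  also have "\<dots> = relabel (on_cols \<sigma>) p"
    unfolding relabel_relabel by (rule relabel_cong) (auto simp: Part_Union[OF p])
  finally show ?thesis .
qed

lemma involution_permutes:
  assumes "\<And>i. f (f i) = i" "\<And>i. i \<notin> S \<Longrightarrow> f i = i"
  shows "f permutes S" and "inv f = f"
proof -
  show "f permutes S" unfolding permutes_def using assms by metis
  show "inv f = f" by (rule inv_unique_comp) (use assms in auto)
qed

lemma twist_eq_pcomp:
  assumes p: "p \<in> Part k"
  shows "ptensor k p (id_diagram k) \<circ>\<^sub>P perm_diagram (2 * k) (swap_halves k) = twist k p"
proof -
  have sw: "swap_halves k permutes {..<2 * k}" "inv (swap_halves k) = swap_halves k"
    by (rule involution_permutes[where S = "{..<2 * k}"]; auto simp: swap_halves_def split: if_splits)+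
  have t: "ptensor k p (id_diagram k) \<in> Part (2 * k)"
    using ptensor_Part[OF p id_diagram_Part, of k] by (simp add: mult_2)
  have "relabel (on_row Top (swap_halves k)) p = relabel (\<lambda>(r, i). (r, if r = Top then k + i else i)) p"
    by (rule relabel_cong) (auto simp: Part_Union[OF p] swap_halves_def)
  moreover have "relabel (on_row Top (swap_halves k) \<circ> shift k) (id_diagram k) =
      {{(Top, i), (Bottom, k + i)} | i. i < k}"
  proof -
    have "id_diagram k = (\<lambda>i. {(Top, i), (Bottom, i)}) ` {..<k}"
      by (auto simp: id_diagram_def)
    then have "relabel (on_row Top (swap_halves k) \<circ> shift k) (id_diagram k) =
        (\<lambda>i. {(Top, swap_halves k (k + i)), (Bottom, k + i)}) ` {..<k}"
      by (simp add: relabel_def image_image)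
    also have "\<dots> = (\<lambda>i. {(Top, i), (Bottom, k + i)}) ` {..<k}"
      by (rule image_cong) (auto simp: swap_halves_def)
    finally show ?thesis by auto
  qed
  ultimately have "relabel (on_row Top (swap_halves k)) (ptensor k p (id_diagram k)) = twist k p"
    unfolding ptensor_shift relabel_Un relabel_relabel twist_def by simp
  then show ?thesis by (simp only: pcomp_perm_right[OF t sw(1)] sw(2))
qed

section \<open>The moment of a product as a moment of its factors\<close>

text \<open>
  The order in which the columns of \<open>a\<^sub>1, \<dots>, a\<^sub>k, b\<^sub>1, \<dots>, b\<^sub>k\<close> occur in \<open>a\<^sub>1, b\<^sub>1, \<dots>, a\<^sub>k, b\<^sub>k\<close>.
\<close>

definition interleave :: "nat \<Rightarrow> nat \<Rightarrow> nat" where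
  "interleave k i = (if i < k then 2 * i else if i < 2 * k then 2 * (i - k) + 1 else i)"

lemma interleave_permutes: "interleave k permutes {..<2 * k}"
proof (rule bij_imp_permutes)
  have "inj_on (interleave k) {..<2 * k}"
    unfolding inj_on_def interleave_def by (auto split: if_splits) presburger+
  moreover have "interleave k ` {..<2 * k} \<subseteq> {..<2 * k}"
    by (auto simp: interleave_def)
  ultimately show "bij_betw (interleave k) {..<2 * k} {..<2 * k}"
    by (simp add: bij_betw_def endo_inj_surj)
qed (simp add: interleave_def)

definition swap_pairs :: "nat \<Rightarrow> nat \<Rightarrow> nat" where
  "swap_pairs k i = (if i < 2 * k then (if even i then i + 1 else i - 1) else i)"

lemma swap_pairs_permutes: "swap_pairs k permutes {..<2 * k}" "inv (swap_pairs k) = swap_pairs k"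
proof -
  have "swap_pairs k (swap_pairs k i) = i" for i
  proof (cases "even i")
    case True
    then obtain j where "i = 2 * j" by (elim evenE)
    then show ?thesis by (simp add: swap_pairs_def)
  next
    case False
    then obtain j where "i = 2 * j + 1" by (elim oddE)
    then show ?thesis by (simp add: swap_pairs_def)
  qed
  then show "swap_pairs k permutes {..<2 * k}" "inv (swap_pairs k) = swap_pairs k"
    by (rule involution_permutes[where S = "{..<2 * k}"]; simp add: swap_pairs_def)+
qed

lemma block_start_replicate: "j \<le> k \<Longrightarrow> block_start (replicate k 2) j = 2 * j"
  by (simp add: block_start_def sum_list_replicate min_def)

lemma foldr_comp: "foldr (\<circ>) fs h = foldr (\<circ>) fs id \<circ> h"
  by (induction fs) auto

lemma block_cycles_pairs: "block_cycles (replicate k 2) = swap_pairs k"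
proof -
  have "foldr (\<circ>) (map (\<lambda>j. transpose (2 * j) (Suc (2 * j))) [0..<n]) id = swap_pairs n" for n
  proof (induction n)
    case 0
    show ?case by (rule ext) (simp add: swap_pairs_def)
  next
    case (Suc n)
    have "foldr (\<circ>) (map (\<lambda>j. transpose (2 * j) (Suc (2 * j))) [0..<Suc n]) id =
        swap_pairs n \<circ> transpose (2 * n) (Suc (2 * n))"
      unfolding Suc.IH[symmetric] foldr_comp[symmetric] by simp
    also have "\<dots> = swap_pairs (Suc n)"
    proof
      fix i
      consider "i < 2 * n" | "i = 2 * n" | "i = Suc (2 * n)" | "i > Suc (2 * n)" by linarith
      then show "(swap_pairs n \<circ> transpose (2 * n) (Suc (2 * n))) i = swap_pairs (Suc n) i"
        by cases (auto simp: swap_pairs_def transpose_def)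
    qed
    finally show ?case .
  qed
  moreover have "map (\<lambda>j. cycle_of_list [block_start (replicate k 2) j ..< block_start (replicate k 2) (Suc j)])
      [0..<k] = map (\<lambda>j. transpose (2 * j) (Suc (2 * j))) [0..<k]"
    by (rule map_cong[OF refl]) (simp add: block_start_replicate upt_conv_Cons)
  ultimately show ?thesis by (simp only: block_cycles_def length_replicate)
qed

lemma concat_pairs:
  assumes "length as = length bs"
  shows "length (concat (map2 (\<lambda>a b. [a, b]) as bs)) = 2 * length as"
    and "i < length as \<Longrightarrow> concat (map2 (\<lambda>a b. [a, b]) as bs) ! (2 * i) = as ! i"
    and "i < length as \<Longrightarrow> concat (map2 (\<lambda>a b. [a, b]) as bs) ! (2 * i + 1) = bs ! i"
  using assms
  by (induction as bs arbitrary: i rule: list_induct2') (simp_all, (auto simp: less_Suc_eq_0_disj)+)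

lemma permute_list_inv:
  assumes "\<sigma> permutes {..<length xs}"
  shows "permute_list (inv \<sigma>) (permute_list \<sigma> xs) = xs"
  using permute_list_compose[OF permutes_inv[OF assms], of \<sigma>] permutes_inv_o[OF assms] by simp

context P_tracial_algebra
begin

lemma m_relabel:
  assumes "p \<in> Part k" "length as = k" "\<sigma> permutes {..<k}"
  shows "m p as = m (relabel (on_cols \<sigma>) p) (permute_list (inv \<sigma>) as)"
  using m_perm[OF assms] pcomp_conjugate[OF assms(1,3)] by simp

text \<open>
  The product axiom, used with \<open>k\<close> factors of length two, evaluates the moment at the list
  \<open>a\<^sub>1, b\<^sub>1, \<dots>, a\<^sub>k, b\<^sub>k\<close>; the permutation axiom then sorts the list, and the diagram that results
  is the twisted one.
\<close>

lemma m_product_pairs: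
  assumes p: "p \<in> Part k" and len: "length as = k" "length bs = k"
  shows "m p (map2 (*) as bs) = m (twist k p) (as @ bs)"
proof -
  let ?ass = "map2 (\<lambda>a b. [a, b]) as bs"
  let ?ns = "replicate k 2 :: nat list"
  let ?ins = "insertion (2 * k) (map (block_start ?ns) [0..<k]) p"
  let ?X = "relabel (on_cols (interleave k)) (twist k p)"
  have ns: "map length ?ass = ?ns"
    using len by (intro nth_equalityI) auto
  have "m p (map nonempty_prod ?ass) = m (?ins \<circ>\<^sub>P perm_diagram (2 * k) (block_cycles ?ns)) (concat ?ass)"
    by (rule m_product[OF p]) (use len ns in \<open>auto simp: sum_list_replicate\<close>)
  moreover have "map nonempty_prod ?ass = map2 (*) as bs"
    by (simp add: case_prod_beta)
  moreover have X: "?X \<in> Part (2 * k)"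
    by (rule relabel_cols_Part[OF twist_Part[OF p] interleave_permutes])
  have ins: "?ins = relabel (on_row Top (swap_pairs k)) ?X"
  proof -
    have mp: "map (block_start ?ns) [0..<k] = map ((*) 2) [0..<k]"
      by (rule map_cong) (auto simp: block_start_replicate)
    let ?E = "{{(Top, i), (Bottom, k + i)} | i. i < k} :: diagram"
    have E: "?E = (\<lambda>i. {(Top, i), (Bottom, k + i)}) ` {..<k}" by auto
    have "relabel (on_row Top (swap_pairs k)) (relabel (on_cols (interleave k)) ?E) =
        (\<lambda>i. {(Top, Suc (2 * i)), (Bottom, Suc (2 * i))}) ` {..<k}"
      unfolding E relabel_def image_image
      by (rule image_cong) (auto simp: interleave_def swap_pairs_def)
    also have "\<dots> = {{(Top, i), (Bottom, i)} | i. i < 2 * k \<and> i \<notin> set (map ((*) 2) [0..<k])}"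
    proof -
      have "{i. i < 2 * k \<and> i \<notin> set (map ((*) 2) [0..<k])} = (\<lambda>i. Suc (2 * i)) ` {..<k}"
      proof (intro set_eqI iffI)
        fix i assume i: "i \<in> {i. i < 2 * k \<and> i \<notin> set (map ((*) 2) [0..<k])}"
        have "odd i"
        proof
          assume "even i"
          then obtain j where "i = 2 * j" by (elim evenE)
          then show False using i by auto
        qed
        then obtain j where "i = 2 * j + 1" by (elim oddE)
        then show "i \<in> (\<lambda>i. Suc (2 * i)) ` {..<k}" using i by auto
      qed (auto, presburger)
      then have "(\<lambda>i. {(Top, i), (Bottom, i)}) ` {i. i < 2 * k \<and> i \<notin> set (map ((*) 2) [0..<k])} =
          (\<lambda>i. {(Top, Suc (2 * i)), (Bottom, Suc (2 * i))}) ` {..<k}"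
        by (simp only: image_image)
      then show ?thesis by blast
    qed
    finally have 1: "relabel (on_row Top (swap_pairs k)) (relabel (on_cols (interleave k)) ?E) = \<dots>" .
    have 2: "relabel (on_row Top (swap_pairs k)) (relabel (on_cols (interleave k))
        (relabel (\<lambda>(r, i). (r, if r = Top then k + i else i)) p)) =
        relabel (\<lambda>(r, j). (r, map ((*) 2) [0..<k] ! j)) p"
      unfolding relabel_relabel
      by (rule relabel_cong) (auto simp: Part_Union[OF p] interleave_def swap_pairs_def)
    show ?thesis unfolding insertion_def mp twist_def relabel_Un 1 2 by (rule refl)
  qed
  moreover have "?ins \<circ>\<^sub>P perm_diagram (2 * k) (block_cycles ?ns) = ?X"
  proof -
    have "?ins \<circ>\<^sub>P perm_diagram (2 * k) (block_cycles ?ns) =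
        relabel (on_row Top (swap_pairs k)) (relabel (on_row Top (swap_pairs k)) ?X)"
      unfolding ins block_cycles_pairs
      using pcomp_perm_right[OF relabel_row_Part[OF X swap_pairs_permutes(1), of Top] swap_pairs_permutes(1)]
      by (simp add: swap_pairs_permutes(2))
    also have "\<dots> = ?X"
      unfolding relabel_relabel[of "on_row Top (swap_pairs k)" "on_row Top (swap_pairs k)"]
    proof (rule relabel_id)
      fix x :: vertex
      show "(on_row Top (swap_pairs k) \<circ> on_row Top (swap_pairs k)) x = x"
        using permutes_inverses(2)[OF swap_pairs_permutes(1), of k "snd x"]
        by (cases x) (simp add: swap_pairs_permutes(2))
    qed
    finally show ?thesis .
  qed
  moreover have "m (twist k p) (as @ bs) = m ?X (concat ?ass)"
  proof -
    have len2: "length (concat ?ass) = 2 * k" using concat_pairs(1)[of as bs] len by simp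
    have pl: "as @ bs = permute_list (interleave k) (concat ?ass)"
    proof (rule nth_equalityI)
      show "length (as @ bs) = length (permute_list (interleave k) (concat ?ass))"
        using len len2 by simp
      fix i assume i: "i < length (as @ bs)"
      then have i': "i < 2 * k" using len by simp
      have "permute_list (interleave k) (concat ?ass) ! i = concat ?ass ! interleave k i"
        by (rule permute_list_nth) (use len2 interleave_permutes i' in simp_all)
      then show "(as @ bs) ! i = permute_list (interleave k) (concat ?ass) ! i"
        using concat_pairs(2)[of as bs i] concat_pairs(3)[of as bs "i - k"] len i'
        by (auto simp: nth_append interleave_def)
    qed
    have "permute_list (inv (interleave k)) (as @ bs) = concat ?ass"
      unfolding pl by (rule permute_list_inv) (use len2 interleave_permutes in simp)
    then show ?thesis
      using m_relabel[OF twist_Part[OF p] _ interleave_permutes, of "as @ bs"] len by simp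
  qed
  ultimately show ?thesis by (simp only:)
qed

end

section \<open>Separating the columns of a diagram\<close>

definition rank_in :: "nat set \<Rightarrow> nat \<Rightarrow> nat" where
  "rank_in I i = card {j \<in> I. j < i}"

lemma rank_in_less:
  assumes "finite I" "i \<in> I" "i < j"
  shows "rank_in I i < rank_in I j"
  unfolding rank_in_def by (rule psubset_card_mono) (use assms in auto)

lemma rank_in_card: "finite I \<Longrightarrow> i \<in> I \<Longrightarrow> rank_in I i < card I"
  unfolding rank_in_def by (rule psubset_card_mono) auto

lemma rank_in_inj: "finite I \<Longrightarrow> inj_on (rank_in I) I"
proof (rule inj_onI)
  fix i j assume "finite I" "i \<in> I" "j \<in> I" "rank_in I i = rank_in I j"
  then show "i = j"
    using rank_in_less[of I i j] rank_in_less[of I j i] by (cases i j rule: linorder_cases) auto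
qed

lemma rank_in_image: "finite I \<Longrightarrow> rank_in I ` I = {..<card I}"
  by (rule card_subset_eq) (auto simp: rank_in_card card_image rank_in_inj)

lemma nths_rank_in: "i \<in> I \<Longrightarrow> i < length xs \<Longrightarrow> nths xs I ! rank_in I i = xs ! i"
proof (induction xs arbitrary: i rule: rev_induct)
  case (snoc x xs)
  have len: "length (nths xs I) = rank_in I (length xs)"
    unfolding length_nths rank_in_def by (rule arg_cong[where f = card]) auto
  have nx: "nths (xs @ [x]) I = nths xs I @ (if length xs \<in> I then [x] else [])"
    by (simp add: nths_append)
  show ?case
  proof (cases "i = length xs")
    case True
    then show ?thesis using snoc.prems unfolding nx by (simp add: nth_append len)
  next
    case False
    then have i: "i < length xs" using snoc.prems by simp
    have "{j \<in> I. j < i} \<subset> {j \<in> I. j < length xs}" using i snoc.prems(1) by auto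
    then have "rank_in I i < rank_in I (length xs)"
      unfolding rank_in_def by (intro psubset_card_mono) auto
    then show ?thesis using snoc.IH[OF snoc.prems(1) i] i unfolding nx by (simp add: nth_append len)
  qed
qed simp

text \<open>
  The permutation that moves the columns in \<open>I\<close> to the front and keeps the order among them and
  among the others.
\<close>

definition separate :: "nat \<Rightarrow> nat set \<Rightarrow> nat \<Rightarrow> nat" where
  "separate n I i = (if i \<in> I then rank_in I i
     else if i < n then card I + rank_in ({..<n} - I) i else i)"

lemma separate_permutes:
  assumes I: "I \<subseteq> {..<n}"
  shows "separate n I permutes {..<n}"
proof (rule bij_imp_permutes)
  let ?J = "{..<n} - I"
  have fin: "finite I" "finite ?J" using I finite_subset by auto
  have card: "card I + card ?J = n"
    using card_Un_disjoint[OF fin] I by (simp add: Un_absorb1)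
  have img: "separate n I ` {..<n} = {..<n}"
  proof -
    have "separate n I ` {..<n} = separate n I ` I \<union> separate n I ` ?J"
      using I by auto
    also have "separate n I ` I = rank_in I ` I"
      by (rule image_cong) (auto simp: separate_def)
    also have "separate n I ` ?J = (+) (card I) ` rank_in ?J ` ?J"
      unfolding image_image by (rule image_cong) (auto simp: separate_def)
    also have "(+) (card I) ` rank_in ?J ` ?J = {card I..<n}"
    proof -
      have "(+) a ` {..<b} = {a..<a + b}" for a b :: nat by (simp add: lessThan_atLeast0 add.commute)
      then show ?thesis unfolding rank_in_image[OF fin(2)] using card by simp
    qed
    also have "rank_in I ` I = {..<card I}" by (rule rank_in_image[OF fin(1)])
    also have "{..<card I} \<union> {card I..<n} = {..<n}" using card by auto
    finally show ?thesis .
  qed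
  then show "bij_betw (separate n I) {..<n} {..<n}"
    unfolding bij_betw_def using finite_surj_inj[of "{..<n}" "separate n I"] by simp
  show "separate n I i = i" if "i \<notin> {..<n}" for i
    using that I by (auto simp: separate_def)
qed

lemma extraction_rank:
  "extraction I p = relabel (on_cols (rank_in I)) (restrict_diagram ({Top, Bottom} \<times> I) p)"
  by (simp add: extraction_def on_cols_def rank_in_def)

lemma restrict_partition:
  assumes p: "p \<in> Part n" and I: "I \<subseteq> {..<n}"
  shows "partition_on ({Top, Bottom} \<times> I) (restrict_diagram ({Top, Bottom} \<times> I) p)"
proof -
  have "partition_on ({Top, Bottom} \<times> {..<n}) p" using p unfolding Part_def by (rule CollectD)
  from partition_on_restrict[OF this, of "{Top, Bottom} \<times> I"]
  show ?thesis using I by (simp add: restrict_diagram_def Int_absorb2 Times_Int_Times Int_commute)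
qed

lemma inj_on_cols: "inj_on f I \<Longrightarrow> inj_on (on_cols f) ({Top, Bottom} \<times> I)"
  by (auto simp: inj_on_def)

lemma extraction_Part:
  assumes p: "p \<in> Part n" and I: "I \<subseteq> {..<n}"
  shows "extraction I p \<in> Part (card I)"
proof -
  have fin: "finite I" using I finite_subset by auto
  have "(\<lambda>i. (r :: row, rank_in I i)) ` I = {r} \<times> {..<card I}" for r
  proof -
    have "(\<lambda>i. (r, rank_in I i)) ` I = (\<lambda>i. (r, i)) ` rank_in I ` I" unfolding image_image by (rule refl)
    then show ?thesis unfolding rank_in_image[OF fin] image_Pair .
  qed
  then have "on_cols (rank_in I) ` ({Top, Bottom} \<times> I) = {Top, Bottom} \<times> {..<card I}"
    unfolding image_two_rows on_cols_simp by auto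
  then show ?thesis
    using partition_relabel[OF restrict_partition[OF p I] inj_on_cols[OF rank_in_inj[OF fin]]]
    unfolding extraction_rank Part_def by simp
qed

text \<open>
  The columns in \<open>I\<close> form a union of cycles of \<open>p\<close>: no block meets columns both inside and outside \<open>I\<close>.
\<close>

definition saturated :: "nat set \<Rightarrow> diagram \<Rightarrow> bool" where
  "saturated I p \<longleftrightarrow> (\<forall>B\<in>p. snd ` B \<subseteq> I \<or> snd ` B \<inter> I = {})"

lemma restrict_saturated:
  assumes p: "p \<in> Part n" and resp: "saturated I p"
  shows "restrict_diagram ({Top, Bottom} \<times> I) p = {B \<in> p. snd ` B \<subseteq> I}"
    and "restrict_diagram ({Top, Bottom} \<times> ({..<n} - I)) p = {B \<in> p. snd ` B \<inter> I = {}}"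
proof -
  have ne: "B \<noteq> {}" if "B \<in> p" for B
    using that p partition_onD3 unfolding Part_def by auto
  have 1: "B \<inter> {Top, Bottom} \<times> I = B" "B \<inter> {Top, Bottom} \<times> ({..<n} - I) = {}"
    if "B \<in> p" "snd ` B \<subseteq> I" for B
    using that Part_vertex[OF p that(1)] by force+
  have 2: "B \<inter> {Top, Bottom} \<times> I = {}" "B \<inter> {Top, Bottom} \<times> ({..<n} - I) = B"
    if "B \<in> p" "snd ` B \<inter> I = {}" for B
    using that Part_vertex[OF p that(1)] by force+
  have im: "(\<lambda>B. B \<inter> V) ` p - {{}} = {B \<in> p. P B}"
    if "\<And>B. B \<in> p \<Longrightarrow> P B \<Longrightarrow> B \<inter> V = B" "\<And>B. B \<in> p \<Longrightarrow> \<not> P B \<Longrightarrow> B \<inter> V = {}" for V P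
  proof (intro set_eqI iffI)
    fix C assume "C \<in> (\<lambda>B. B \<inter> V) ` p - {{}}"
    then obtain B where "B \<in> p" "C = B \<inter> V" "C \<noteq> {}" by auto
    then show "C \<in> {B \<in> p. P B}" using that[of B] by (cases "P B") auto
  next
    fix C assume "C \<in> {B \<in> p. P B}"
    then show "C \<in> (\<lambda>B. B \<inter> V) ` p - {{}}" using that(1)[of C] ne[of C]
      by (intro DiffI image_eqI[of _ _ C]) auto
  qed
  have cases: "snd ` B \<subseteq> I \<or> snd ` B \<inter> I = {}" if "B \<in> p" for B
    using resp that unfolding saturated_def by (rule bspec)
  show "restrict_diagram ({Top, Bottom} \<times> I) p = {B \<in> p. snd ` B \<subseteq> I}"
    unfolding restrict_diagram_def using 1(1) 2(1) cases by (intro im) metis+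
  show "restrict_diagram ({Top, Bottom} \<times> ({..<n} - I)) p = {B \<in> p. snd ` B \<inter> I = {}}"
    unfolding restrict_diagram_def using 1(2) 2(2) cases by (intro im) metis+
qed

lemma relabel_separate:
  assumes p: "p \<in> Part n" and I: "I \<subseteq> {..<n}" and resp: "saturated I p"
  shows "relabel (on_cols (separate n I)) p =
    ptensor (card I) (extraction I p) (extraction ({..<n} - I) p)"
proof -
  let ?V = "\<lambda>I. {Top, Bottom} \<times> I"
  let ?J = "{..<n} - I"
  have "p = restrict_diagram (?V I) p \<union> restrict_diagram (?V ?J) p"
    unfolding restrict_saturated[OF p resp] using resp by (auto simp: saturated_def)
  then have "relabel (on_cols (separate n I)) p =
      relabel (on_cols (separate n I)) (restrict_diagram (?V I) p) \<union>
      relabel (on_cols (separate n I)) (restrict_diagram (?V ?J) p)"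
    by (metis relabel_Un)
  also have "relabel (on_cols (separate n I)) (restrict_diagram (?V I) p) = extraction I p"
    unfolding extraction_rank
    by (rule relabel_cong)
      (auto simp: partition_onD1[OF restrict_partition[OF p I], symmetric] separate_def)
  also have "relabel (on_cols (separate n I)) (restrict_diagram (?V ?J) p) =
      relabel (shift (card I)) (extraction ?J p)"
    unfolding extraction_rank relabel_relabel
    by (rule relabel_cong)
      (auto simp: partition_onD1[OF restrict_partition[OF p, of ?J], symmetric] separate_def)
  finally show ?thesis by (simp add: ptensor_shift)
qed

lemma card_restrict:
  assumes p: "p \<in> Part n" and I: "I \<subseteq> {..<n}"
  shows "card (restrict_diagram ({Top, Bottom} \<times> I) p) = card {B \<in> p. snd ` B \<inter> I \<noteq> {}}"
proof -
  have part: "partition_on ({Top, Bottom} \<times> {..<n}) p" using p unfolding Part_def by (rule CollectD)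
  let ?V = "{Top, Bottom} \<times> I"
  have meet: "B \<inter> ?V \<noteq> {} \<longleftrightarrow> snd ` B \<inter> I \<noteq> {}" if "B \<in> p" for B
  proof
    assume "snd ` B \<inter> I \<noteq> {}"
    then obtain r i where "(r, i) \<in> B" "i \<in> I" by force
    then have "(r, i) \<in> B \<inter> ?V" using Part_vertex[OF p that] by auto
    then show "B \<inter> ?V \<noteq> {}" by blast
  qed force
  have "restrict_diagram ?V p = (\<lambda>B. B \<inter> ?V) ` {B \<in> p. snd ` B \<inter> I \<noteq> {}}"
    unfolding restrict_diagram_def using meet by auto
  moreover have "inj_on (\<lambda>B. B \<inter> ?V) {B \<in> p. snd ` B \<inter> I \<noteq> {}}"
  proof (rule inj_onI)
    fix B C assume BC: "B \<in> {B \<in> p. snd ` B \<inter> I \<noteq> {}}" "C \<in> {B \<in> p. snd ` B \<inter> I \<noteq> {}}"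
      and eq: "B \<inter> ?V = C \<inter> ?V"
    then obtain x where "x \<in> B \<inter> ?V" using meet by blast
    then have "x \<in> B" "x \<in> C" using eq by auto
    then show "B = C" using partition_block_unique[OF part, of B C x] BC by simp
  qed
  ultimately show ?thesis by (simp add: card_image)
qed

lemma nc_extraction:
  assumes p: "p \<in> Part n" and I: "I \<subseteq> {..<n}"
  shows "nc (extraction I p) = card {B \<in> p. snd ` B \<inter> I \<noteq> {}}"
proof -
  have fin: "finite I" using I finite_subset by auto
  have "inj_on ((`) (on_cols (rank_in I))) (restrict_diagram ({Top, Bottom} \<times> I) p)"
    by (rule inj_on_image)
      (simp add: partition_onD1[OF restrict_partition[OF p I], symmetric] inj_on_cols rank_in_inj fin)
  then show ?thesis
    unfolding nc_def extraction_rank relabel_def by (simp add: card_image card_restrict[OF p I])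
qed

text \<open>
  A block that meets columns both inside and outside \<open>I\<close> is counted in both extractions, every other
  block in one.  So the condition that defines factorizations says that there is no such block.
\<close>

lemma nc_extraction_saturated:
  assumes p: "p \<in> Part n" and I: "I \<subseteq> {..<n}"
  shows "nc (extraction I p) + nc (extraction ({..<n} - I) p) = nc p \<longleftrightarrow> saturated I p"
proof -
  let ?P = "{B \<in> p. snd ` B \<inter> I \<noteq> {}}" and ?Q = "{B \<in> p. snd ` B \<inter> ({..<n} - I) \<noteq> {}}"
  have part: "partition_on ({Top, Bottom} \<times> {..<n}) p" using p unfolding Part_def by (rule CollectD)
  have fin: "finite p" by (rule finite_elements[OF _ part]) simp
  have sub: "snd ` B \<subseteq> {..<n}" if "B \<in> p" for B using Part_vertex[OF p that] by auto
  have ne: "snd ` B \<noteq> {}" if "B \<in> p" for B using that partition_onD3[OF part] by auto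
  have cov: "snd ` B \<inter> I \<noteq> {} \<or> snd ` B \<inter> ({..<n} - I) \<noteq> {}" if "B \<in> p" for B
    using sub[OF that] ne[OF that] by blast
  have "?P \<union> ?Q = p" using cov by blast
  then have "card ?P + card ?Q = card p + card (?P \<inter> ?Q)"
    using card_Un_Int[of ?P ?Q] fin by simp
  then have "card ?P + card ?Q = card p \<longleftrightarrow> ?P \<inter> ?Q = {}"
    using fin by auto
  also have "\<dots> \<longleftrightarrow> saturated I p"
  proof -
    have "snd ` B \<inter> ({..<n} - I) = {} \<longleftrightarrow> snd ` B \<subseteq> I" if "B \<in> p" for B
      using sub[OF that] by blast
    then have "saturated I p \<longleftrightarrow> (\<forall>B\<in>p. snd ` B \<inter> ({..<n} - I) = {} \<or> snd ` B \<inter> I = {})"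
      unfolding saturated_def by simp
    moreover have "?P \<inter> ?Q = {} \<longleftrightarrow> (\<forall>B\<in>p. snd ` B \<inter> ({..<n} - I) = {} \<or> snd ` B \<inter> I = {})"
      unfolding disjoint_iff mem_Collect_eq by blast
    ultimately show ?thesis by (simp only:)
  qed
  finally show ?thesis
    by (simp only: nc_extraction[OF p I] nc_extraction[OF p Diff_subset] nc_def[of p])
qed

section \<open>Freeness, inversion and symmetry of cumulants\<close>

text \<open>
  A block that meets both kinds of columns lies in a cycle that contains columns of both algebras.
\<close>

lemma P_free_vanish:
  assumes free: "P_free \<kappa> A1 A2" and p: "p \<in> Part n" and len: "length cs = n"
    and cs: "\<And>i. i < n \<Longrightarrow> cs ! i \<in> (if i \<in> I then A1 else A2)" and nresp: "\<not> saturated I p"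
  shows "\<kappa> p cs = 0"
proof -
  obtain B where B: "B \<in> p" "\<not> snd ` B \<subseteq> I" "snd ` B \<inter> I \<noteq> {}"
    using nresp by (auto simp: saturated_def)
  obtain r i where i: "(r, i) \<in> B" "i \<in> I" using B(3) by force
  obtain s j where j: "(s, j) \<in> B" "j \<notin> I" using B(2) by force
  have lt: "i < n" "j < n" using Part_vertex[OF p B(1)] i j by auto
  define \<epsilon> :: "nat \<Rightarrow> nat" where "\<epsilon> i = (if i \<in> I then 1 else 2)" for i
  let ?F = "p \<union> id_diagram n"
  have tops: "((r', l), (Top, l)) \<in> linked ?F" if "(r', l) \<in> B" for r' l
  proof -
    have "(r' = Top \<or> r' = Bottom) \<and> l < n" by (rule Part_vertex[OF p B(1) that])
    then show ?thesis
      by (intro linkedI[of "{(Top, l), (Bottom, l)}"]) (auto simp: id_diagram_def)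
  qed
  have ij: "((Top, i), (Top, j)) \<in> linked ?F"
    using linked_sym[OF tops[OF i(1)]] tops[OF j(1)] linkedI[of B ?F "(r, i)" "(s, j)"] B(1) i(1) j(1)
    by (blast intro: linked_trans)
  have ii: "((Top, i), (Top, i)) \<in> linked ?F"
    using linked_field[OF ij] by (simp add: linked_refl)
  have "linked ?F `` {(Top, i)} \<in> cycles n p"
    unfolding cycles_def pjoin_def components_linked using linked_field[OF ij] by (intro quotientI) simp
  then have "\<exists>C\<in>cycles n p. \<exists>i<n. \<exists>j<n. (Top, i) \<in> C \<and> (Top, j) \<in> C \<and> \<epsilon> i \<noteq> \<epsilon> j"
    using ij ii lt i(2) j(2) by (intro bexI[of _ "linked ?F `` {(Top, i)}"] exI[of _ i] exI[of _ j] conjI)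
      (auto simp: \<epsilon>_def)
  moreover have "\<forall>i<n. \<epsilon> i \<in> {1, 2} \<and> cs ! i \<in> (if \<epsilon> i = 1 then A1 else A2)"
  proof (intro allI impI)
    fix i assume "i < n"
    from cs[OF this] show "\<epsilon> i \<in> {1, 2} \<and> cs ! i \<in> (if \<epsilon> i = 1 then A1 else A2)"
      by (simp add: \<epsilon>_def split: if_splits)
  qed
  ultimately show ?thesis using free p len unfolding P_free_def by blast
qed

lemma P_free_tensor:
  assumes "P_free \<kappa> A1 A2" "p1 \<in> Part k1" "p2 \<in> Part k2" "length as = k1" "length bs = k2"
    "set as \<subseteq> A1" "set bs \<subseteq> A2"
  shows "\<kappa> (ptensor k1 p1 p2) (as @ bs) = \<kappa> p1 as * \<kappa> p2 bs"
proof -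
  note * = assms(1)[unfolded P_free_def, THEN conjunct2, THEN spec, THEN spec, THEN spec, THEN spec,
    THEN spec, THEN spec]
  show ?thesis
    using *[THEN mp, OF assms(2), THEN mp, OF assms(3), THEN mp, OF assms(4), THEN mp, OF assms(5),
      THEN mp, OF assms(6), THEN mp, OF assms(7)] .
qed

text \<open>
  The sums over the lower sets of the order determine a function: all other terms of the sum at \<open>p\<close>
  belong to diagrams strictly closer to the identity.
\<close>

lemma moebius_unique:
  fixes f g :: "diagram \<Rightarrow> complex"
  assumes sums: "\<And>p. p \<in> Part k \<Longrightarrow> (\<Sum>p'\<in>{p'\<in>Part k. pleq k p' p}. f p') = (\<Sum>p'\<in>{p'\<in>Part k. pleq k p' p}. g p')"
    and p: "p \<in> Part k"
  shows "f p = g p"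
  using p
proof (induction "card {q\<in>Part k. pdist (id_diagram k) q < pdist (id_diagram k) p}"
    arbitrary: p rule: less_induct)
  case less
  let ?S = "{p'\<in>Part k. p \<in> Part k \<and> pleq k p' p \<and> p' \<noteq> p}"
  have "f p' = g p'" if "p' \<in> ?S" for p'
  proof (rule less.hyps)
    show "p' \<in> Part k" using that by simp
    then have "{q\<in>Part k. pdist (id_diagram k) q < pdist (id_diagram k) p'} \<subset>
        {q\<in>Part k. pdist (id_diagram k) q < pdist (id_diagram k) p}"
      using pleq_strict[of p' k p] that by auto
    then show "card {q\<in>Part k. pdist (id_diagram k) q < pdist (id_diagram k) p'} <
        card {q\<in>Part k. pdist (id_diagram k) q < pdist (id_diagram k) p}"
      by (auto intro!: psubset_card_mono simp: finite_Part)
  qed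
  then have "(\<Sum>p'\<in>?S. f p') = (\<Sum>p'\<in>?S. g p')" by (rule sum.cong[OF refl])
  then show ?case using sums[OF less.prems] unfolding sum_pleq[OF less.prems] by simp
qed

lemma ncyc_relabel_cols:
  assumes \<sigma>: "\<sigma> permutes {..<k}"
  shows "ncyc (relabel (on_cols \<sigma>) p) = ncyc p"
proof -
  have "(`) snd ` relabel (on_cols \<sigma>) p = (`) \<sigma> ` (`) snd ` p"
    unfolding relabel_def image_image by (intro image_cong refl) (auto simp: on_cols_def)
  moreover have "ncomp ((`) \<sigma> ` (`) snd ` p) = ncomp ((`) snd ` p)"
    by (rule ncomp_inj) (use permutes_inj[OF \<sigma>] in \<open>auto intro: inj_on_subset\<close>)
  ultimately show ?thesis by (simp add: ncyc_def)
qed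

lemma inj_on_cols_permutes: "\<sigma> permutes S \<Longrightarrow> inj (on_cols \<sigma>)"
  using permutes_inj[of \<sigma> S] by (auto simp: inj_def)

lemma pleq_relabel_cols:
  assumes \<sigma>: "\<sigma> permutes {..<k}" and p: "p \<in> Part k" and q: "q \<in> Part k"
  shows "pleq k (relabel (on_cols \<sigma>) p) (relabel (on_cols \<sigma>) q) \<longleftrightarrow> pleq k p q"
proof -
  have n: "ncomp (relabel (on_cols \<sigma>) p) = ncomp p" for p
    unfolding relabel_def
    by (rule ncomp_inj, rule inj_on_subset[OF inj_on_cols_permutes[OF \<sigma>]]) simp
  show ?thesis
    unfolding pleq_iff[OF p q] pleq_iff[OF relabel_cols_Part[OF p \<sigma>] relabel_cols_Part[OF q \<sigma>]]
      relabel_Un[symmetric] n ncyc_relabel_cols[OF \<sigma>] by (rule refl)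
qed

lemma relabel_cols_inverse:
  assumes \<sigma>: "\<sigma> permutes S"
  shows "relabel (on_cols (inv \<sigma>)) (relabel (on_cols \<sigma>) p) = p"
    and "relabel (on_cols \<sigma>) (relabel (on_cols (inv \<sigma>)) p) = p"
proof -
  have "on_cols (inv \<sigma>) (on_cols \<sigma> x) = x" "on_cols \<sigma> (on_cols (inv \<sigma>) x) = x" for x
    by (cases x; simp add: permutes_inverses[OF \<sigma>])+
  then show "relabel (on_cols (inv \<sigma>)) (relabel (on_cols \<sigma>) p) = p"
    "relabel (on_cols \<sigma>) (relabel (on_cols (inv \<sigma>)) p) = p"
    unfolding relabel_relabel by (simp_all add: relabel_id)
qed

lemma P_cumulants_sum:
  "P_cumulants scale m \<kappa> \<Longrightarrow> p \<in> Part k \<Longrightarrow> length as = k \<Longrightarrow>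
    m p as = (\<Sum>p'\<in>{p'\<in>Part k. pleq k p' p}. \<kappa> p' as)"
  by (simp add: P_cumulants_def)

text \<open>
  The moments are invariant under permutations of the columns and the order is too, so the relabelled
  cumulants solve the equations that determine the cumulants.
\<close>

lemma cumulant_relabel:
  assumes alg: "P_tracial_algebra scale m" and \<kappa>: "P_cumulants scale m \<kappa>"
    and p: "p \<in> Part k" and len: "length as = k" and \<sigma>: "\<sigma> permutes {..<k}"
  shows "\<kappa> p as = \<kappa> (relabel (on_cols \<sigma>) p) (permute_list (inv \<sigma>) as)"
  using p
proof (rule moebius_unique[rotated])
  let ?as = "permute_list (inv \<sigma>) as"
  let ?R = "relabel (on_cols \<sigma>)"
  fix q assume q: "q \<in> Part k"
  have "(\<Sum>p'\<in>{p'\<in>Part k. pleq k p' q}. \<kappa> p' as) = m q as"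
    using P_cumulants_sum[OF \<kappa> q len] by simp
  also have "\<dots> = m (?R q) ?as"
    by (rule P_tracial_algebra.m_relabel[OF alg q len \<sigma>])
  also have "\<dots> = (\<Sum>p'\<in>{p'\<in>Part k. pleq k p' (?R q)}. \<kappa> p' ?as)"
    by (rule P_cumulants_sum[OF \<kappa> relabel_cols_Part[OF q \<sigma>]]) (simp add: len)
  also have "\<dots> = (\<Sum>p'\<in>{p'\<in>Part k. pleq k p' q}. \<kappa> (?R p') ?as)"
  proof (rule sum.reindex_bij_witness[of _ ?R "relabel (on_cols (inv \<sigma>))"])
    fix p' assume "p' \<in> {p'\<in>Part k. pleq k p' (?R q)}"
    then have p': "p' \<in> Part k" "pleq k p' (?R q)" by auto
    show "?R (relabel (on_cols (inv \<sigma>)) p') = p'" by (rule relabel_cols_inverse(2)[OF \<sigma>])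
    show "relabel (on_cols (inv \<sigma>)) p' \<in> {p'\<in>Part k. pleq k p' q}"
      using pleq_relabel_cols[OF \<sigma> relabel_cols_Part[OF p'(1) permutes_inv[OF \<sigma>]] q]
        p' relabel_cols_Part[OF p'(1) permutes_inv[OF \<sigma>]]
      by (simp add: relabel_cols_inverse(2)[OF \<sigma>])
    show "\<kappa> (?R (relabel (on_cols (inv \<sigma>)) p')) ?as = \<kappa> p' ?as"
      by (simp add: relabel_cols_inverse(2)[OF \<sigma>])
  next
    fix p' assume "p' \<in> {p'\<in>Part k. pleq k p' q}"
    then show "relabel (on_cols (inv \<sigma>)) (?R p') = p'" "?R p' \<in> {p'\<in>Part k. pleq k p' (?R q)}"
      using pleq_relabel_cols[OF \<sigma> _ q] relabel_cols_Part[OF _ \<sigma>] relabel_cols_inverse(1)[OF \<sigma>] by auto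
  qed
  finally show "(\<Sum>p'\<in>{p'\<in>Part k. pleq k p' q}. \<kappa> p' as) =
      (\<Sum>p'\<in>{p'\<in>Part k. pleq k p' q}. \<kappa> (?R p') ?as)" .
qed

section \<open>Cumulants of sums and moments of products\<close>

definition choose_from :: "nat set \<Rightarrow> 'a list \<Rightarrow> 'a list \<Rightarrow> 'a list" where
  "choose_from I as bs = map (\<lambda>i. if i \<in> I then as ! i else bs ! i) [0..<length as]"

lemma multilinear_add:
  assumes "multilinear_form scale k f" "length as = k" "i < k"
  shows "f (as[i := x + y]) = f (as[i := x]) + f (as[i := y])"
proof -
  have "Vector_Spaces.linear scale (*) (\<lambda>x. f (as[i := x]))"
    using assms by (auto simp: multilinear_form_def)
  then show ?thesis by (rule Vector_Spaces.linear.axioms(3)[THEN module_hom.add])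
qed

lemma multilinear_expand:
  fixes f :: "'a::ab_group_add list \<Rightarrow> complex"
  assumes f: "multilinear_form scale k f" and len: "length as = k" "length bs = k"
  shows "f (map2 (+) as bs) = (\<Sum>I\<in>Pow {..<k}. f (choose_from I as bs))"
proof -
  \<comment> \<open>The first \<open>n\<close> entries are already chosen, the others are still sums.\<close>
  define part where "part n I = map (\<lambda>i. if i < n then (if i \<in> I then as ! i else bs ! i)
      else as ! i + bs ! i) [0..<k]" for n I
  have "f (part 0 {}) = (\<Sum>I\<in>Pow {..<n}. f (part n I))" if "n \<le> k" for n
    using that
  proof (induction n)
    case (Suc n)
    then have n: "n < k" by simp
    have step: "f (part n I) = f (part (Suc n) I) + f (part (Suc n) (insert n I))"
      if "I \<subseteq> {..<n}" for I
    proof -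
      have "n \<notin> I" using that by auto
      then have "part n I = (part n I)[n := bs ! n + as ! n]"
        "part (Suc n) I = (part n I)[n := bs ! n]"
        "part (Suc n) (insert n I) = (part n I)[n := as ! n]"
        using n by (auto simp: part_def nth_list_update add.commute intro!: nth_equalityI)
      moreover have "length (part n I) = k" by (simp add: part_def)
      ultimately show ?thesis using multilinear_add[OF f _ n, of "part n I" "bs ! n" "as ! n"] by metis
    qed
    have "f (part 0 {}) = (\<Sum>I\<in>Pow {..<n}. f (part n I))" using Suc by simp
    also have "\<dots> = (\<Sum>I\<in>Pow {..<n}. f (part (Suc n) I)) + (\<Sum>I\<in>Pow {..<n}. f (part (Suc n) (insert n I)))"
      using step by (simp add: sum.distrib)
    also have "(\<Sum>I\<in>Pow {..<n}. f (part (Suc n) (insert n I))) =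
        (\<Sum>I\<in>insert n ` Pow {..<n}. f (part (Suc n) I))"
    proof (subst sum.reindex)
      show "inj_on (insert n) (Pow {..<n})"
        by (rule inj_on_inverseI[of _ "\<lambda>X. X - {n}"]) auto
    qed simp
    also have "(\<Sum>I\<in>Pow {..<n}. f (part (Suc n) I)) + (\<Sum>I\<in>insert n ` Pow {..<n}. f (part (Suc n) I)) =
        (\<Sum>I\<in>Pow {..<n} \<union> insert n ` Pow {..<n}. f (part (Suc n) I))"
      by (rule sum.union_disjoint[symmetric]) auto
    also have "Pow {..<n} \<union> insert n ` Pow {..<n} = Pow {..<Suc n}"
      by (simp add: lessThan_Suc Pow_insert)
    finally show ?case .
  qed simp
  from this[of k] have "f (part 0 {}) = (\<Sum>I\<in>Pow {..<k}. f (part k I))" by simp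
  moreover have "part 0 {} = map2 (+) as bs"
    using len by (auto simp: part_def intro!: nth_equalityI)
  moreover have "part k I = choose_from I as bs" for I
    using len by (auto simp: part_def choose_from_def)
  ultimately show ?thesis by simp
qed

lemma permute_choose_from:
  assumes I: "I \<subseteq> {..<k}" and len: "length as = k" "length bs = k"
  shows "permute_list (inv (separate k I)) (choose_from I as bs) = nths as I @ nths bs ({..<k} - I)"
proof -
  let ?J = "{..<k} - I"
  have fin: "finite I" "finite ?J" using I finite_subset by auto
  have ln: "length (nths as I) = card I" "length (nths bs ?J) = card ?J"
    unfolding length_nths len using I by (auto intro!: arg_cong[where f = card])
  have card: "card I + card ?J = k"
    using card_Un_disjoint[OF fin] I by (simp add: Un_absorb1)
  have perm: "separate k I permutes {..<length (nths as I @ nths bs ?J)}"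
    using separate_permutes[OF I] by (simp add: ln card)
  have "choose_from I as bs = permute_list (separate k I) (nths as I @ nths bs ?J)"
  proof (rule nth_equalityI)
    show "length (choose_from I as bs) = length (permute_list (separate k I) (nths as I @ nths bs ?J))"
      by (simp add: choose_from_def len ln card)
    fix i assume "i < length (choose_from I as bs)"
    then have i: "i < k" by (simp add: choose_from_def len)
    have "permute_list (separate k I) (nths as I @ nths bs ?J) ! i =
        (nths as I @ nths bs ?J) ! separate k I i"
      by (rule permute_list_nth[OF perm]) (simp add: ln card i)
    also have "\<dots> = (if i \<in> I then as ! i else bs ! i)"
      using i nths_rank_in[of i I as] nths_rank_in[of i ?J bs] rank_in_card[OF fin(1)]
      by (simp add: separate_def nth_append ln len)
    finally show "choose_from I as bs ! i =
        permute_list (separate k I) (nths as I @ nths bs ?J) ! i"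
      using i by (simp add: choose_from_def len)
  qed
  then show ?thesis by (simp add: permute_list_inv[OF perm])
qed

text \<open>
  In the multilinear expansion, the term with letters \<open>a\<^sub>i\<close> for \<open>i \<in> I\<close> and \<open>b\<^sub>i\<close> otherwise vanishes unless
  \<open>I\<close> is a union of cycles.  In that case sorting the columns turns \<open>p\<close> into a tensor product, on
  which the cumulants of free algebras factorize.
\<close>

lemma cumulant_sum_of_free:
  assumes alg: "P_tracial_algebra scale m" and \<kappa>: "P_cumulants scale m \<kappa>"
    and free: "P_free \<kappa> A1 A2"
    and as: "length as = k" "set as \<subseteq> A1" and bs: "length bs = k" "set bs \<subseteq> A2"
    and p: "p \<in> Part k"
  shows "\<kappa> p (map2 (+) as bs) =
     (\<Sum>(p1, p2, I)\<in>factorizations2 k p. \<kappa> p1 (nths as I) * \<kappa> p2 (nths bs ({..<k} - I)))"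
proof -
  let ?J = "\<lambda>I. {..<k} - I"
  let ?t = "\<lambda>I. (extraction I p, extraction (?J I) p, I)"
  have summand: "\<kappa> p (choose_from I as bs) =
      (if saturated I p then \<kappa> (extraction I p) (nths as I) * \<kappa> (extraction (?J I) p) (nths bs (?J I)) else 0)"
    if I: "I \<in> Pow {..<k}" for I
  proof (cases "saturated I p")
    case True
    have I': "I \<subseteq> {..<k}" using I by simp
    have ln: "length (nths as I) = card I" "length (nths bs (?J I)) = card (?J I)"
      unfolding length_nths as bs using I' by (auto intro!: arg_cong[where f = card])
    have "\<kappa> p (choose_from I as bs) =
        \<kappa> (relabel (on_cols (separate k I)) p) (permute_list (inv (separate k I)) (choose_from I as bs))"
      by (rule cumulant_relabel[OF alg \<kappa> p _ separate_permutes[OF I']]) (simp add: choose_from_def as)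
    also have "\<dots> = \<kappa> (ptensor (card I) (extraction I p) (extraction (?J I) p)) (nths as I @ nths bs (?J I))"
      by (simp only: relabel_separate[OF p I' True] permute_choose_from[OF I' as(1) bs(1)])
    also have "\<dots> = \<kappa> (extraction I p) (nths as I) * \<kappa> (extraction (?J I) p) (nths bs (?J I))"
      by (rule P_free_tensor[OF free extraction_Part[OF p I'] extraction_Part[OF p] ln])
        (use set_nths_subset[of as I] set_nths_subset[of bs "?J I"] as bs in auto)
    finally show ?thesis using True by simp
  next
    case False
    have "\<kappa> p (choose_from I as bs) = 0"
    proof (rule P_free_vanish[OF free p _ _ False])
      show "choose_from I as bs ! i \<in> (if i \<in> I then A1 else A2)" if "i < k" for i
        using that as bs nth_mem[of i as] nth_mem[of i bs] by (auto simp: choose_from_def)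
    qed (simp add: choose_from_def as)
    then show ?thesis using False by simp
  qed
  have fact: "factorizations2 k p = ?t ` {I \<in> Pow {..<k}. saturated I p}"
    unfolding factorizations2_def using nc_extraction_saturated[OF p] by auto
  have ml: "multilinear_form scale k (\<kappa> p)" using \<kappa> p by (simp add: P_cumulants_def)
  have "\<kappa> p (map2 (+) as bs) = (\<Sum>I\<in>Pow {..<k}. \<kappa> p (choose_from I as bs))"
    by (rule multilinear_expand[OF ml as(1) bs(1)])
  also have "\<dots> = (\<Sum>I\<in>Pow {..<k}. if saturated I p then
      \<kappa> (extraction I p) (nths as I) * \<kappa> (extraction (?J I) p) (nths bs (?J I)) else 0)"
    by (rule sum.cong[OF refl summand])
  also have "\<dots> = (\<Sum>I\<in>{I \<in> Pow {..<k}. saturated I p}.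
      \<kappa> (extraction I p) (nths as I) * \<kappa> (extraction (?J I) p) (nths bs (?J I)))"
    by (rule sum.inter_filter[symmetric]) simp
  also have "\<dots> = (\<Sum>(p1, p2, I)\<in>factorizations2 k p. \<kappa> p1 (nths as I) * \<kappa> p2 (nths bs (?J I)))"
    unfolding fact by (subst sum.reindex) (auto simp: inj_on_def)
  finally show ?thesis .
qed

text \<open>
  For the first \<open>k\<close> columns, the separating permutation is the identity.
\<close>

lemma ptensor_of_saturated:
  assumes q: "q \<in> Part (k + l)" and resp: "saturated {..<k} q"
  shows "\<exists>p1\<in>Part k. \<exists>p2\<in>Part l. q = ptensor k p1 p2"
proof -
  have sub: "{..<k} \<subseteq> {..<k + l}" by auto
  have "q = relabel (on_cols (separate (k + l) {..<k})) q"
  proof (rule relabel_id[symmetric])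
    fix x assume "x \<in> \<Union>q"
    obtain r i where x: "x = (r, i)" by (cases x)
    have i: "i < k + l" using \<open>x \<in> \<Union>q\<close> unfolding x Part_Union[OF q] by simp
    have "separate (k + l) {..<k} i = i"
    proof (cases "i < k")
      case True
      then have "{j \<in> {..<k}. j < i} = {..<i}" by auto
      then show ?thesis using True by (simp add: separate_def rank_in_def)
    next
      case False
      then have "{j \<in> {..<k + l} - {..<k}. j < i} = {k..<i}" using i by auto
      then show ?thesis using False i by (simp add: separate_def rank_in_def)
    qed
    then show "on_cols (separate (k + l) {..<k}) x = x" by (simp add: x)
  qed
  also have "\<dots> = ptensor k (extraction {..<k} q) (extraction ({..<k + l} - {..<k}) q)"
    using relabel_separate[OF q sub resp] by simp
  finally have "q = ptensor k (extraction {..<k} q) (extraction ({..<k + l} - {..<k}) q)" .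
  moreover have "extraction {..<k} q \<in> Part k" using extraction_Part[OF q sub] by simp
  moreover have "extraction ({..<k + l} - {..<k}) q \<in> Part l"
  proof -
    have "card ({..<k + l} - {..<k}) = l" using sub by (simp add: card_Diff_subset)
    then show ?thesis using extraction_Part[OF q Diff_subset, of "{..<k}"] by (simp only:)
  qed
  ultimately show ?thesis by blast
qed

text \<open>
  The columns of a block of \<open>p1 \<otimes> p2\<close> tell which factor it comes from.
\<close>

lemma ptensor_inj:
  assumes "p1 \<in> Part k" "p2 \<in> Part l" "p1' \<in> Part k" "p2' \<in> Part l"
    and eq: "ptensor k p1 p2 = ptensor k p1' p2'"
  shows "p1 = p1' \<and> p2 = p2'"
proof -
  have left: "p = {B \<in> ptensor k p q. snd ` B \<subseteq> {..<k}}"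
    and right: "q = {B. B \<noteq> {} \<and> shift k ` B \<in> ptensor k p q}" if p: "p \<in> Part k" and q: "q \<in> Part l" for p q
  proof -
    have neq: "B \<noteq> {}" if "B \<in> q" for B
      using that partition_onD3[OF q[unfolded Part_def, THEN CollectD]] by auto
    have pk: "snd ` B \<subseteq> {..<k}" if "B \<in> p" for B using Part_vertex[OF p that] by auto
    have sh: "\<not> snd ` shift k ` B \<subseteq> {..<k}" if "B \<noteq> {}" for B
    proof -
      obtain x where "x \<in> B" using \<open>B \<noteq> {}\<close> by auto
      moreover obtain r i where "x = (r, i)" by (cases x)
      ultimately have "k + i \<in> snd ` shift k ` B" by force
      then show ?thesis by auto
    qed
    have inj: "B = C" if "shift k ` B = shift k ` C" for B C
      using that inj_image_eq_iff[OF inj_shift[of k UNIV]] by simp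
    have mem: "C \<in> ptensor k p q \<longleftrightarrow> C \<in> p \<or> (\<exists>B\<in>q. C = shift k ` B)" for C
      by (auto simp: ptensor_shift relabel_def)
    show "p = {B \<in> ptensor k p q. snd ` B \<subseteq> {..<k}}"
    proof (intro set_eqI iffI)
      fix C assume "C \<in> {B \<in> ptensor k p q. snd ` B \<subseteq> {..<k}}"
      then have C: "C \<in> ptensor k p q" "snd ` C \<subseteq> {..<k}" by simp_all
      show "C \<in> p"
      proof (rule ccontr)
        assume "C \<notin> p"
        then obtain B where "B \<in> q" "C = shift k ` B" using C(1) mem by auto
        then show False using C(2) sh neq by simp
      qed
    qed (use pk mem in simp)
    show "q = {B. B \<noteq> {} \<and> shift k ` B \<in> ptensor k p q}"
    proof (intro set_eqI iffI)
      fix C assume "C \<in> {B. B \<noteq> {} \<and> shift k ` B \<in> ptensor k p q}"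
      then have C: "C \<noteq> {}" "shift k ` C \<in> ptensor k p q" by simp_all
      then have "shift k ` C \<notin> p" using pk[of "shift k ` C"] sh[OF C(1)] by auto
      then obtain B where "B \<in> q" "shift k ` C = shift k ` B" using C(2) mem by auto
      then show "C \<in> q" using inj by blast
    next
      fix C assume "C \<in> q"
      then show "C \<in> {B. B \<noteq> {} \<and> shift k ` B \<in> ptensor k p q}" using neq mem by auto
    qed
  qed
  have "p1 = p1'"
    by (rule trans[OF left[OF assms(1,2), unfolded eq] left[OF assms(3,4), symmetric]])
  moreover have "p2 = p2'"
    by (rule trans[OF right[OF assms(1,2), unfolded eq] right[OF assms(3,4), symmetric]])
  ultimately show ?thesis by simp
qed

text \<open>
  Among the diagrams below \<open>twist k p\<close>, freeness only leaves those without a cycle through both halves,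
  and these are the tensor products.
\<close>

lemma moment_product_free:
  assumes alg: "P_tracial_algebra scale m" and \<kappa>: "P_cumulants scale m \<kappa>"
    and free: "P_free \<kappa> A1 A2"
    and as: "length as = k" "set as \<subseteq> A1" and bs: "length bs = k" "set bs \<subseteq> A2"
    and p: "p \<in> Part k"
  shows "m p (map2 (*) as bs) =
    (\<Sum>p1\<in>Part k. \<Sum>p2\<in>{p2\<in>Part k. pleq (2 * k) (ptensor k p1 p2) (twist k p)}. \<kappa> p1 as * \<kappa> p2 bs)"
proof -
  let ?S = "{q \<in> Part (2 * k). pleq (2 * k) q (twist k p)}"
  let ?D = "SIGMA p1:Part k. {p2\<in>Part k. pleq (2 * k) (ptensor k p1 p2) (twist k p)}"
  let ?t = "\<lambda>(p1, p2). ptensor k p1 p2"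
  have "m p (map2 (*) as bs) = m (twist k p) (as @ bs)"
    by (rule P_tracial_algebra.m_product_pairs[OF alg p as(1) bs(1)])
  also have "\<dots> = (\<Sum>q\<in>?S. \<kappa> q (as @ bs))"
    by (rule P_cumulants_sum[OF \<kappa> twist_Part[OF p]]) (simp add: as bs)
  also have "\<dots> = (\<Sum>q\<in>?t ` ?D. \<kappa> q (as @ bs))"
  proof (rule sum.mono_neutral_right)
    show "finite ?S" by (simp add: finite_Part)
    show "?t ` ?D \<subseteq> ?S" using ptensor_Part[of _ k _ k] by (auto simp: mult_2)
    show "\<forall>q\<in>?S - ?t ` ?D. \<kappa> q (as @ bs) = 0"
    proof
      fix q assume q: "q \<in> ?S - ?t ` ?D"
      have "\<not> saturated {..<k} q"
      proof
        assume "saturated {..<k} q"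
        then obtain p1 p2 where "p1 \<in> Part k" "p2 \<in> Part k" "q = ptensor k p1 p2"
          using ptensor_of_saturated[of q k k] q by (auto simp: mult_2)
        then have "q \<in> ?t ` ?D" using q by (intro image_eqI[of _ _ "(p1, p2)"]) auto
        then show False using q by blast
      qed
      then show "\<kappa> q (as @ bs) = 0"
      proof (rule P_free_vanish[OF free, of q "2 * k", rotated 3])
        show "(as @ bs) ! i \<in> (if i \<in> {..<k} then A1 else A2)" if "i < 2 * k" for i
          using that as bs nth_mem[of i as] nth_mem[of "i - k" bs] by (auto simp: nth_append)
      qed (use q as bs in auto)
    qed
  qed
  also have "\<dots> = (\<Sum>(p1, p2)\<in>?D. \<kappa> p1 as * \<kappa> p2 bs)"
  proof (subst sum.reindex)
    show "inj_on ?t ?D"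
    proof (rule inj_onI)
      fix x y assume "x \<in> ?D" "y \<in> ?D" "?t x = ?t y"
      then show "x = y" using ptensor_inj[of "fst x" k "snd x" k "fst y" "snd y"] by (cases x; cases y) simp
    qed
    show "(\<Sum>x\<in>?D. ((\<lambda>q. \<kappa> q (as @ bs)) \<circ> ?t) x) = (\<Sum>(p1, p2)\<in>?D. \<kappa> p1 as * \<kappa> p2 bs)"
      by (rule sum.cong[OF refl]) (auto simp: P_free_tensor[OF free _ _ as(1) bs(1) as(2) bs(2)])
  qed
  also have "\<dots> = (\<Sum>p1\<in>Part k. \<Sum>p2\<in>{p2\<in>Part k. pleq (2 * k) (ptensor k p1 p2) (twist k p)}. \<kappa> p1 as * \<kappa> p2 bs)"
    by (rule sum.Sigma[symmetric]) (simp_all add: finite_Part)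
  finally show ?thesis .
qed

lemma kreweras_twist:
  "p \<in> Part k \<Longrightarrow> kreweras k p p1 =
    {p2 \<in> Part k. p1 \<circ>\<^sub>P p2 = p \<and> pleq (2 * k) (ptensor k p1 p2) (twist k p)}"
  by (simp add: kreweras_def twist_eq_pcomp)

theorem theorem2p2:
  fixes scale :: "complex \<Rightarrow> 'a::ring \<Rightarrow> 'a"
    and m \<kappa> :: "diagram \<Rightarrow> 'a list \<Rightarrow> complex"
    and A1 A2 :: "'a set"
    and k :: nat and as bs :: "'a list" and p :: diagram
  assumes "P_tracial_algebra scale m"
    and "P_cumulants scale m \<kappa>"
    and "complex_algebra.subalgebra scale A1" and "complex_algebra.subalgebra scale A2"
    and "P_free \<kappa> A1 A2"
    and "length as = k" and "set as \<subseteq> A1"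
    and "length bs = k" and "set bs \<subseteq> A2"
    and "p \<in> Part k"
  shows
    "\<kappa> p (map2 (+) as bs) =
       (\<Sum>(p1, p2, I)\<in>factorizations2 k p. \<kappa> p1 (nths as I) * \<kappa> p2 (nths bs ({..<k} - I))) \<and>
     \<kappa> p (map2 (*) as bs) =
       (\<Sum>p1\<in>{p1\<in>Part k. pprec k p1 p}. \<Sum>p2\<in>kreweras k p p1. \<kappa> p1 as * \<kappa> p2 bs) \<and>
     m p (map2 (*) as bs) =
       (\<Sum>p1\<in>{p1\<in>Part k. pleq k p1 p}. \<kappa> p1 as * m (flip p1 \<circ>\<^sub>P p) bs)"
proof (intro conjI)
  note alg = assms(1) and \<kappa> = assms(2) and free = assms(5)
    and as = assms(6,7) and bs = assms(8,9) and p = assms(10)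
  note moment = moment_product_free[OF alg \<kappa> free as bs]
  show "\<kappa> p (map2 (+) as bs) =
       (\<Sum>(p1, p2, I)\<in>factorizations2 k p. \<kappa> p1 (nths as I) * \<kappa> p2 (nths bs ({..<k} - I)))"
    by (rule cumulant_sum_of_free[OF alg \<kappa> free as bs p])
  show "\<kappa> p (map2 (*) as bs) =
       (\<Sum>p1\<in>{p1\<in>Part k. pprec k p1 p}. \<Sum>p2\<in>kreweras k p p1. \<kappa> p1 as * \<kappa> p2 bs)"
  proof -
    let ?g = "\<lambda>p. \<Sum>p1\<in>Part k. \<Sum>p2\<in>kreweras k p p1. \<kappa> p1 as * \<kappa> p2 bs"
    have "\<kappa> p (map2 (*) as bs) = ?g p"
    proof (rule moebius_unique[OF _ p])
      fix q assume q: "q \<in> Part k"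
      \<comment> \<open>The pairs below the twist of \<open>q\<close> are grouped by their composition, which runs through the lower set of \<open>q\<close>.\<close>
      let ?L = "{p' \<in> Part k. pleq k p' q}"
      have "(\<Sum>p'\<in>?L. ?g p') = (\<Sum>p1\<in>Part k. \<Sum>p'\<in>?L. \<Sum>p2\<in>kreweras k p' p1. \<kappa> p1 as * \<kappa> p2 bs)"
        by (rule sum.swap)
      also have "\<dots> = (\<Sum>p1\<in>Part k. \<Sum>p2\<in>{p2\<in>Part k. pleq (2 * k) (ptensor k p1 p2) (twist k q)}. \<kappa> p1 as * \<kappa> p2 bs)"
      proof (rule sum.cong[OF refl])
        fix p1 assume p1: "p1 \<in> Part k"
        let ?T = "{p2\<in>Part k. pleq (2 * k) (ptensor k p1 p2) (twist k q)}"
        have "(\<Sum>p2\<in>?T. \<kappa> p1 as * \<kappa> p2 bs) =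
            (\<Sum>p'\<in>?L. \<Sum>p2\<in>{p2 \<in> ?T. p1 \<circ>\<^sub>P p2 = p'}. \<kappa> p1 as * \<kappa> p2 bs)"
          by (rule sum.group[symmetric])
            (use pleq_twist_pcomp[OF p1 _ q] pcomp_Part[OF p1] in \<open>auto simp: finite_Part\<close>)
        also have "\<dots> = (\<Sum>p'\<in>?L. \<Sum>p2\<in>kreweras k p' p1. \<kappa> p1 as * \<kappa> p2 bs)"
        proof (rule sum.cong[OF refl], rule sum.cong[OF _ refl])
          fix p' assume "p' \<in> ?L"
          then show "{p2 \<in> ?T. p1 \<circ>\<^sub>P p2 = p'} = kreweras k p' p1"
            using pleq_twist_pcomp[OF p1 _ q] by (auto simp: kreweras_twist)
        qed
        finally show "(\<Sum>p'\<in>?L. \<Sum>p2\<in>kreweras k p' p1. \<kappa> p1 as * \<kappa> p2 bs) =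
            (\<Sum>p2\<in>?T. \<kappa> p1 as * \<kappa> p2 bs)" by simp
      qed
      also have "\<dots> = m q (map2 (*) as bs)" by (rule moment[OF q, symmetric])
      also have "\<dots> = (\<Sum>p'\<in>?L. \<kappa> p' (map2 (*) as bs))"
        by (rule P_cumulants_sum[OF \<kappa> q]) (simp add: as bs)
      finally show "(\<Sum>p'\<in>?L. \<kappa> p' (map2 (*) as bs)) = (\<Sum>p'\<in>?L. ?g p')" by (rule sym)
    qed
    also have "\<dots> = (\<Sum>p1\<in>{p1\<in>Part k. pprec k p1 p}. \<Sum>p2\<in>kreweras k p p1. \<kappa> p1 as * \<kappa> p2 bs)"
      by (rule sum.mono_neutral_right) (auto simp: finite_Part pprec_def)
    finally show ?thesis .
  qed
  show "m p (map2 (*) as bs) =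
       (\<Sum>p1\<in>{p1\<in>Part k. pleq k p1 p}. \<kappa> p1 as * m (flip p1 \<circ>\<^sub>P p) bs)"
  proof -
    let ?T = "\<lambda>p1. {p2\<in>Part k. pleq (2 * k) (ptensor k p1 p2) (twist k p)}"
    have "m p (map2 (*) as bs) = (\<Sum>p1\<in>Part k. \<Sum>p2\<in>?T p1. \<kappa> p1 as * \<kappa> p2 bs)"
      by (rule moment[OF p])
    also have "\<dots> = (\<Sum>p1\<in>{p1\<in>Part k. pleq k p1 p}. \<Sum>p2\<in>?T p1. \<kappa> p1 as * \<kappa> p2 bs)"
    proof (rule sum.mono_neutral_right)
      show "\<forall>p1\<in>Part k - {p1\<in>Part k. pleq k p1 p}. (\<Sum>p2\<in>?T p1. \<kappa> p1 as * \<kappa> p2 bs) = 0"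
        using pleq_twist_flip[OF _ _ p] by (auto intro!: sum.neutral)
    qed (auto simp: finite_Part)
    also have "\<dots> = (\<Sum>p1\<in>{p1\<in>Part k. pleq k p1 p}. \<kappa> p1 as * m (flip p1 \<circ>\<^sub>P p) bs)"
    proof (rule sum.cong[OF refl])
      fix p1 assume "p1 \<in> {p1\<in>Part k. pleq k p1 p}"
      then have p1: "p1 \<in> Part k" "pleq k p1 p" by auto
      have "?T p1 = {p2\<in>Part k. pleq k p2 (flip p1 \<circ>\<^sub>P p)}"
        using pleq_twist_flip[OF p1(1) _ p] p1(2) by auto
      then show "(\<Sum>p2\<in>?T p1. \<kappa> p1 as * \<kappa> p2 bs) = \<kappa> p1 as * m (flip p1 \<circ>\<^sub>P p) bs"
        using P_cumulants_sum[OF \<kappa> pcomp_Part[OF flip_Part[OF p1(1)] p] bs(1)]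
        by (simp add: sum_distrib_left)
    qed
    finally show ?thesis .
  qed
qed

end
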